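(* Let $d\in\mathbb{N}$, let $\tau>0$, and let $\mathcal{U}$ be the set of nonempty bounded subsets $\mathcal{Z}$ of $M_d(\mathbb{R})\times M_d(\mathbb{R})$. Endow $\mathcal{U}$ with the topology induced by the Hausdorff distance. Then the function $\mathcal{Z}\mapsto\lambda(\Sigma_{\mathcal{Z},\tau})$ is continuous on $\mathcal{U}$.
   Context: $\mathbb{N}$ is the set of positive integers. $M_d(\mathbb{R})$ is the set of $d\times d$ real matrices, $\|\cdot\|$ the operator norm induced by the Euclidean norm. Convention: $\log 0=-\infty$. The Hausdorff distance between nonempty subsets $X,Y$ of a Euclidean space $\mathbb{R}^n$ is $d_H(X,Y)=\max\{\sup_{x\in X}\inf_{y\in Y}|x-y|,\ \sup_{y\in Y}\inf_{x\in X}|x-y|\}$; here $M_d(\mathbb{R})\times M_d(\mathbb{R})$ is identified with $\mathbb{R}^{2d^2}$. (On bounded, not necessarily closed, sets $d_H$ is a pseudo-distance; the topology is the one it generates.) Switching signals. $\mathcal{S}_{\mathcal{Z}}$ is the set of right-continuous piecewise-constant functions $Z=(Z_1(\cdot),Z_2(\cdot)):[0,+\infty)\to\mathcal{Z}$, each given together with a strictly increasing sequence of switching times $(t_k)_{k\in\Theta^\star(Z)}$ in $(0,+\infty)$ having no finite accumulation point, where $\Theta^\star(Z)$ is $\emptyset$, $\{1,\dots,N\}$ for some $N\in\mathbb{N}$, or $\mathbb{N}$ (no, $N$, or infinitely many switchings). Set $t_0=0$ and, if $\Theta^\star(Z)$ is finite with cardinality $N$, $t_{N+1}=+\infty$.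 Let $\Theta(Z)=\{0\}\cup\Theta^\star(Z)$. The function $Z$ is constant on $[t_k,t_{k+1})$ for every $k\in\Theta(Z)$; it is allowed that $Z$ takes the same value on two consecutive intervals. $\mathcal{S}_{\mathcal{Z},\tau}\subset \mathcal{S}_{\mathcal{Z}}$ is the set of signals with $t_{k+1}\ge t_k+\tau$ for all $k\in\Theta(Z)$. Impulsive switched system. $\Sigma_{\mathcal{Z},\tau}$ is the system in $\mathbb{R}^d$ $$\dot x(t)=Z_1(t_k)x(t),\ t\in[t_k,t_{k+1}),\ k\in\Theta(Z);\qquad x(t_k)=Z_2(t_{k-1})\lim_{t\nearrow t_k}x(t),\ k\in\Theta^\star(Z),$$ for $Z\in\mathcal{S}_{\mathcal{Z},\tau}$. $\Phi_Z(t,0)$ is the matrix mapping $x(0)$ to $x(t)$ for the solution associated with $Z$. The maximal Lyapunov exponent is $$\lambda(\Sigma_{\mathcal{Z},\tau})=\limsup_{t\to+\infty}\frac1t\sup_{Z\in\mathcal{S}_{\mathcal{Z},\tau}}\log(\|\Phi_Z(t,0)\|).$$ *)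

theory Defs
  imports "HOL-Analysis.Analysis"
begin

type_synonym 'n mode = "(real^'n^'n) \<times> (real^'n^'n)"

definition op_norm :: "real^'n^'n \<Rightarrow> real" where
  "op_norm A = onorm ((*v) A)"

text \<open>The logarithm on \<open>[0, \<infinity>)\<close> with \<open>log 0 = -\<infinity>\<close>; in the library \<open>ln 0 = 0\<close>.\<close>

definition elog :: "real \<Rightarrow> ereal" where
  "elog r = (if r = 0 then -\<infinity> else ereal (ln r))"

subsection \<open>Hausdorff distance\<close>

text \<open>Real-valued, hence meaningful only for nonempty bounded sets. The type \<^typ>\<open>'n mode\<close>
  carries the Euclidean metric of all matrix entries.\<close>

definition hausdorff_dist :: "'a::metric_space set \<Rightarrow> 'a set \<Rightarrow> real" where
  "hausdorff_dist X Y =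
     max (SUP x\<in>X. INF y\<in>Y. dist x y) (SUP y\<in>Y. INF x\<in>X. dist x y)"

definition bounded_sets :: "'a::metric_space set set" where
  "bounded_sets = {X. X \<noteq> {} \<and> bounded X}"

definition hausdorff_topology :: "'a::metric_space set topology" where
  "hausdorff_topology =
     topology_generated_by
       {{Y \<in> bounded_sets. hausdorff_dist X Y < r} | X r. X \<in> bounded_sets \<and> 0 < r}"

lemma topspace_hausdorff_topology: "topspace hausdorff_topology = bounded_sets"
proof -
  have self: "X \<in> {Y \<in> bounded_sets. hausdorff_dist X Y < 1}"
    if "X \<in> bounded_sets" for X :: "'a set"
  proof -
    have "(INF y\<in>X. dist x y) = 0" if "x \<in> X" for x
    proof (rule antisym)
      have "(INF y\<in>X. dist x y) \<le> dist x x"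
        by (rule cINF_lower) (use that in \<open>auto intro: bdd_belowI[of _ 0]\<close>)
      then show "(INF y\<in>X. dist x y) \<le> 0"
        by simp
      show "0 \<le> (INF y\<in>X. dist x y)"
        by (rule cINF_greatest) (use that in auto)
    qed
    moreover from this have "(INF y\<in>X. dist y x) = 0" if "x \<in> X" for x
      using that by (simp add: dist_commute[of _ x])
    moreover have "X \<noteq> {}"
      using that by (simp add: bounded_sets_def)
    ultimately show ?thesis
      using that by (simp add: hausdorff_dist_def)
  qed
  show ?thesis
    unfolding hausdorff_topology_def topology_generated_by_topspace
  proof
    show "bounded_sets \<subseteq> \<Union> {{Y \<in> bounded_sets. hausdorff_dist X Y < r} |X r.
            (X :: 'a set) \<in> bounded_sets \<and> 0 < r}"
    proof
      fix X :: "'a set"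
      assume X: "X \<in> bounded_sets"
      have "{Y \<in> bounded_sets. hausdorff_dist X Y < 1} \<in>
              {{Y \<in> bounded_sets. hausdorff_dist X Y < r} |X r.
                 (X :: 'a set) \<in> bounded_sets \<and> 0 < r}"
        using X zero_less_one by blast
      then show "X \<in> \<Union> {{Y \<in> bounded_sets. hausdorff_dist X Y < r} |X r.
                    (X :: 'a set) \<in> bounded_sets \<and> 0 < r}"
        using self[OF X] by (rule UnionI)
    qed
  qed auto
qed

subsection \<open>Switching signals\<close>

text \<open>A signal carries its value function, its number of switchings (possibly \<open>\<infinity>\<close>) and its
  switching times. Only \<open>val Z t\<close> for \<open>t \<ge> 0\<close> and \<open>tm Z k\<close> for \<open>k \<in> steps0 Z\<close> are
  relevant. \<open>steps Z\<close> is the index set \<open>\<Theta>\<^sup>\<star>(Z)\<close> and \<open>steps0 Z\<close> is \<open>\<Theta>(Z)\<close>.\<close>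

record 'v signal =
  val :: "real \<Rightarrow> 'v"
  num :: enat
  tm :: "nat \<Rightarrow> real"

definition steps :: "'v signal \<Rightarrow> nat set" where
  "steps Z = {k. 1 \<le> k \<and> enat k \<le> num Z}"

definition steps0 :: "'v signal \<Rightarrow> nat set" where
  "steps0 Z = insert 0 (steps Z)"

text \<open>\<open>t\<^sub>k\<^sub>+\<^sub>1\<close>, which is \<open>+\<infinity>\<close> after the last switching.\<close>

definition next_tm :: "'v signal \<Rightarrow> nat \<Rightarrow> ereal" where
  "next_tm Z k = (if Suc k \<in> steps Z then ereal (tm Z (Suc k)) else \<infinity>)"

definition phase :: "'v signal \<Rightarrow> nat \<Rightarrow> real set" where
  "phase Z k = {t. tm Z k \<le> t \<and> ereal t < next_tm Z k}"

text \<open>Constancy on every half-open phase already makes the signal right-continuous and piecewise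
  constant.\<close>

definition signals :: "'v set \<Rightarrow> 'v signal set" where
  "signals S = {Z.
     (\<forall>t\<ge>0. val Z t \<in> S) \<and>
     tm Z 0 = 0 \<and>
     (\<forall>k\<in>steps Z. 0 < tm Z k) \<and>
     strict_mono_on (steps Z) (tm Z) \<and>
     (\<forall>x. \<not> x islimpt (tm Z ` steps Z)) \<and>
     (\<forall>k\<in>steps0 Z. \<forall>t\<in>phase Z k. val Z t = val Z (tm Z k))}"

definition dwell_signals :: "'v set \<Rightarrow> real \<Rightarrow> 'v signal set" where
  "dwell_signals S \<tau> =
     {Z \<in> signals S. \<forall>k\<in>steps0 Z. ereal (tm Z k + \<tau>) \<le> next_tm Z k}"

subsection \<open>Impulsive switched system\<close>

definition is_solution :: "('n::finite) mode signal \<Rightarrow> (real \<Rightarrow> real^'n) \<Rightarrow> bool" where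
  "is_solution Z x \<longleftrightarrow>
     (\<forall>k\<in>steps0 Z. \<forall>t\<in>phase Z k.
        (x has_vector_derivative fst (val Z (tm Z k)) *v x t) (at t within phase Z k)) \<and>
     (\<forall>k\<in>steps Z. \<exists>l. (x \<longlongrightarrow> l) (at_left (tm Z k)) \<and>
        x (tm Z k) = snd (val Z (tm Z (k - 1))) *v l)"

text \<open>The matrix \<open>\<Phi>\<^sub>Z(t, 0)\<close> for \<open>t \<ge> 0\<close>. For \<open>Z \<in> signals S\<close> every initial value admits a
  solution, whose restriction to \<open>[0, \<infinity>)\<close> is unique, so the description is proper.\<close>

definition flow_matrix :: "('n::finite) mode signal \<Rightarrow> real \<Rightarrow> real^'n^'n" where
  "flow_matrix Z t = (THE M. \<forall>x. is_solution Z x \<longrightarrow> x t = M *v x 0)"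

definition lyap_exp :: "('n::finite) mode set \<Rightarrow> real \<Rightarrow> ereal" where
  "lyap_exp S \<tau> =
     Limsup at_top (\<lambda>t::real.
       ereal (1 / t) * (SUP Z\<in>dwell_signals S \<tau>. elog (op_norm (flow_matrix Z t))))"

end

theory Submission
  imports Defs
begin

text \<open>
  Continuity at a set \<open>S\<close> means that the Lyapunov exponent \<open>\<lambda>\<close> is controlled by what happens in bounded
  time, uniformly over a neighbourhood of \<open>S\<close>. The growth over a finite time bounds \<open>\<lambda>\<close> from above and
  depends continuously on \<open>S\<close>, which settles upper semicontinuity. The difficulty is lower
  semicontinuity: the growth over a finite time must not exceed \<open>\<lambda>\<close> by much, with constants that
  depend on a bound of \<open>S\<close> only. This is \<open>uniform_growth\<close>: for modes bounded by \<open>K\<close>, all products of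
  complete phases of total duration \<open>T\<close> have norm at most \<open>exp ((\<lambda> + \<epsilon>) * T + c)\<close>, where \<open>c\<close> depends
  only on \<open>K\<close>, \<open>\<tau>\<close>, \<open>\<epsilon>\<close> and the dimension \<open>d\<close>.

  The source of uniformity is an inequality of Bochi's type, \<open>norm_prod_contractions_le\<close>. If \<open>d\<close> matrices
  of Euclidean norm at most \<open>1\<close> contract some norm \<open>N\<close> by a factor \<open>q\<close>, then their product has Euclidean
  norm at most \<open>d\<^sup>2 2\<^sup>d q\<close>, no matter how distorted \<open>N\<close> is. In a basis chosen greedily for \<open>N\<close> every matrix
  is strictly triangular up to entries of order \<open>q\<close>, and a product of \<open>d\<close> strictly triangular matrices
  vanishes. Apply this to the norm adapted to a rate \<open>\<omega>\<close> slightly above the exponent: if products are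
  known to grow at most at rate \<open>\<beta>\<close>, cutting a long product into \<open>d\<close> pieces improves \<open>\<beta>\<close> to
  \<open>\<beta> - (\<beta> - \<omega>) / (2 * d)\<close> (\<open>growth_bounded_improve\<close>). The exponent is at least \<open>- K\<close>, so the initial gap
  is bounded and the number of improvements is uniform (\<open>growth_bounded_uniform\<close>). Phases too long
  to be cut are governed by constant signals, to which the same argument is applied first.

  With uniform constants the adapted norm is equivalent to the Euclidean norm by a uniform factor.
  A perturbation of the modes that is small against this factor raises the rate at most by \<open>\<epsilon>\<close>
  (\<open>growth_bounded_perturb\<close>). Therefore the exponents of two sets of modes bounded by \<open>K\<close> and
  close in the Hausdorff distance differ by at most \<open>\<epsilon>\<close> (\<open>lyap_exp_perturb\<close>).
\<close>

section \<open>Endomorphisms as a Banach algebra\<close>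

text \<open>Multiplication on \<^typ>\<open>real^'n^'n\<close> is entrywise. This copy of the bounded operators has composition
  as its multiplication, so that \<^const>\<open>exp\<close> and its calculus in Banach algebras describe linear flows.\<close>

typedef (overloaded) 'a endo = "UNIV :: ('a::real_normed_vector \<Rightarrow>\<^sub>L 'a) set"
  morphisms blinfun_of_endo Endo ..

setup_lifting type_definition_endo

instantiation endo :: (euclidean_space) real_normed_algebra_1
begin

lift_definition zero_endo :: "'a endo" is 0 .
lift_definition one_endo :: "'a endo" is id_blinfun .
lift_definition plus_endo :: "'a endo \<Rightarrow> 'a endo \<Rightarrow> 'a endo" is "(+)" .
lift_definition minus_endo :: "'a endo \<Rightarrow> 'a endo \<Rightarrow> 'a endo" is "(-)" .
lift_definition uminus_endo :: "'a endo \<Rightarrow> 'a endo" is uminus .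
lift_definition times_endo :: "'a endo \<Rightarrow> 'a endo \<Rightarrow> 'a endo" is "(o\<^sub>L)" .
lift_definition scaleR_endo :: "real \<Rightarrow> 'a endo \<Rightarrow> 'a endo" is scaleR .
lift_definition norm_endo :: "'a endo \<Rightarrow> real" is norm .
lift_definition dist_endo :: "'a endo \<Rightarrow> 'a endo \<Rightarrow> real" is dist .
lift_definition sgn_endo :: "'a endo \<Rightarrow> 'a endo" is sgn .

definition uniformity_endo :: "('a endo \<times> 'a endo) filter" where
  "uniformity_endo = (INF e\<in>{0<..}. principal {(x, y). dist x y < e})"

definition open_endo :: "'a endo set \<Rightarrow> bool" where
  "open_endo U = (\<forall>x\<in>U. \<forall>\<^sub>F (x', y) in uniformity. x' = x \<longrightarrow> y \<in> U)"

instance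
proof
  show "\<And>a b c :: 'a endo. (a + b) * c = a * c + b * c"
    by transfer (auto intro!: blinfun_eqI simp: blinfun.bilinear_simps)
  show "\<And>a b c :: 'a endo. a * (b + c) = a * b + a * c"
    by transfer (auto intro!: blinfun_eqI simp: blinfun.bilinear_simps)
  show "\<And>(r::real) (x::'a endo) y. r *\<^sub>R x * y = r *\<^sub>R (x * y)"
    by transfer (auto intro!: blinfun_eqI simp: blinfun.bilinear_simps)
  show "\<And>(r::real) (x::'a endo) y. x * r *\<^sub>R y = r *\<^sub>R (x * y)"
    by transfer (auto intro!: blinfun_eqI simp: blinfun.bilinear_simps)
  show "\<And>x y :: 'a endo. norm (x * y) \<le> norm x * norm y"
    by transfer (rule norm_blinfun_compose)
  show "(0::'a endo) \<noteq> 1"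
    by transfer (metis norm_blinfun_id norm_zero zero_neq_one)
  show "\<And>a b c :: 'a endo. a * b * c = a * (b * c)"
    by transfer (auto intro!: blinfun_eqI)
  show "\<And>a :: 'a endo. 1 * a = a"
    by transfer (auto intro!: blinfun_eqI)
  show "\<And>a :: 'a endo. a * 1 = a"
    by transfer (auto intro!: blinfun_eqI)
  show "\<And>a b c :: 'a endo. a + b + c = a + (b + c)"
    by transfer (rule add.assoc)
  show "\<And>a b :: 'a endo. a + b = b + a"
    by transfer (rule add.commute)
  show "\<And>a b :: 'a endo. a - b = a + - b"
    by transfer simp
  show "\<And>(r::real) (x::'a endo) y. r *\<^sub>R (x + y) = r *\<^sub>R x + r *\<^sub>R y"
    by transfer (rule scaleR_add_right)
  show "\<And>(r::real) s (x::'a endo). (r + s) *\<^sub>R x = r *\<^sub>R x + s *\<^sub>R x"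
    by transfer (rule scaleR_add_left)
  show "\<And>(x::'a endo) y. norm (x + y) \<le> norm x + norm y"
    by transfer (rule norm_triangle_ineq)
  show "\<And>(x::'a endo) y. dist x y = norm (x - y)"
    by transfer (rule dist_norm)
  show "\<And>x::'a endo. sgn x = inverse (norm x) *\<^sub>R x"
    by transfer (rule sgn_div_norm)
  show "\<And>a :: 'a endo. 0 + a = a"
    by transfer (rule add_0)
  show "\<And>a :: 'a endo. - a + a = 0"
    by transfer (rule left_minus)
  show "\<And>r s (a :: 'a endo). r *\<^sub>R s *\<^sub>R a = (r * s) *\<^sub>R a"
    by transfer (rule scaleR_scaleR)
  show "\<And>a :: 'a endo. 1 *\<^sub>R a = a"
    by transfer (rule scaleR_one)
  show "\<And>a :: 'a endo. norm a = 0 \<longleftrightarrow> a = 0"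
    by transfer (rule norm_eq_zero)
  show "\<And>r (a :: 'a endo). norm (r *\<^sub>R a) = \<bar>r\<bar> * norm a"
    by transfer (rule norm_scaleR)
  show "norm (1 :: 'a endo) = 1"
    by transfer (rule norm_blinfun_id)
qed (fact uniformity_endo_def open_endo_def)+

end

lift_definition app :: "'a::euclidean_space endo \<Rightarrow> 'a \<Rightarrow> 'a" is blinfun_apply .

lemma app_bilinear: "bounded_bilinear app"
proof
  show "\<exists>K. \<forall>(A::'a endo) x. norm (app A x) \<le> norm A * norm x * K"
    by (rule exI[of _ 1]) (transfer, simp add: norm_blinfun)
  show "\<And>A B (x::'a). app (A + B) x = app A x + app B x"
    by transfer (rule blinfun.add_left)
  show "\<And>A (x::'a) y. app A (x + y) = app A x + app A y"
    by transfer (rule blinfun.add_right)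
  show "\<And>r A (x::'a). app (r *\<^sub>R A) x = r *\<^sub>R app A x"
    by transfer (rule blinfun.scaleR_left)
  show "\<And>r A (x::'a). app A (r *\<^sub>R x) = r *\<^sub>R app A x"
    by transfer (rule blinfun.scaleR_right)
qed

interpretation app: bounded_bilinear app
  by (rule app_bilinear)

instance endo :: (euclidean_space) banach
proof
  fix X :: "nat \<Rightarrow> 'a endo"
  assume X: "Cauchy X"
  have iso: "dist (blinfun_of_endo A) (blinfun_of_endo B) = dist A B" for A B :: "'a endo"
    by transfer simp
  have "Cauchy (\<lambda>n. blinfun_of_endo (X n))"
    using X by (simp add: Cauchy_def iso)
  then obtain L where "(\<lambda>n. blinfun_of_endo (X n)) \<longlonglongrightarrow> L"
    by (auto simp: Cauchy_convergent_iff convergent_def)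
  then have "X \<longlonglongrightarrow> Endo L"
    by (simp add: lim_sequentially flip: iso) (simp add: Endo_inverse)
  then show "convergent X"
    by (auto simp: convergent_def)
qed

lemma app_one [simp]: "app 1 x = x"
  by transfer simp

lemma app_mult: "app (A * B) x = app A (app B x)"
  by transfer simp

lemma norm_app: "norm (app A x) \<le> norm A * norm x"
  by transfer (rule norm_blinfun)

lemma endo_eqI: "(\<And>x. app A x = app B x) \<Longrightarrow> A = B"
  by transfer (rule blinfun_eqI)

lemma norm_endo_le:
  assumes "0 \<le> b" "\<And>x. norm x = 1 \<Longrightarrow> norm (app A x) \<le> b"
  shows "norm A \<le> b"
proof -
  have "norm (app A x) \<le> b * norm x" for x
  proof (cases "x = 0")
    case False
    then show ?thesis
      using assms(2)[of "x /\<^sub>R norm x"] by (simp add: app.scaleR_right field_simps)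
  qed (simp add: app.zero_right)
  with assms(1) show ?thesis
    by transfer (rule norm_blinfun_bound)
qed

lift_definition endo_of :: "real^'n^'n \<Rightarrow> (real^'n::finite) endo"
  is "\<lambda>M. Blinfun ((*v) M)" .

lemma app_endo_of [simp]: "app (endo_of M) x = M *v x"
  by transfer (simp add: bounded_linear_Blinfun_apply matrix_vector_mul_bounded_linear)

lemma norm_endo_of: "norm (endo_of M) = op_norm M"
  unfolding op_norm_def
  by transfer (simp add: norm_blinfun.rep_eq bounded_linear_Blinfun_apply matrix_vector_mul_bounded_linear)

lemma bounded_linear_endo_of: "bounded_linear (endo_of :: real^'n^'n \<Rightarrow> (real^'n::finite) endo)"
proof -
  have "linear (endo_of :: real^'n^'n \<Rightarrow> (real^'n) endo)"
    by (rule linearI)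
      (auto intro!: endo_eqI simp: app.add_left app.scaleR_left matrix_vector_mult_add_rdistrib
        scaleR_matrix_vector_assoc)
  then show ?thesis
    by (simp add: linear_conv_bounded_linear)
qed

lemma surj_endo_of: "\<exists>M. endo_of M = A"
proof
  have "linear (app A)"
    by (simp add: app.bounded_linear_right bounded_linear.linear)
  then show "endo_of (matrix (app A)) = A"
    by (intro endo_eqI) (simp add: matrix_works)
qed

section \<open>A greedy orthonormal basis for a norm\<close>

locale equivalent_norm =
  fixes N :: "'a::euclidean_space \<Rightarrow> real" and L :: real
  assumes N_triangle: "N (x + y) \<le> N x + N y"
    and N_scaleR: "N (c *\<^sub>R x) = \<bar>c\<bar> * N x"
    and norm_le_N: "norm x \<le> N x"
    and N_le_norm: "N x \<le> L * norm x"
begin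

lemma N_nonneg: "0 \<le> N x"
  using norm_le_N[of x] norm_ge_zero[of x] by linarith

lemma N_diff: "N (x - y) \<le> N x + N y"
  using N_triangle[of x "(-1) *\<^sub>R y"] N_scaleR[of "-1" y] by simp

lemma continuous_on_N: "continuous_on X N"
proof -
  have L: "0 \<le> L"
    using N_le_norm[of "SOME b. b \<in> Basis"] N_nonneg[of "SOME b. b \<in> Basis"]
    by (simp add: SOME_Basis)
  have "\<bar>N x - N y\<bar> \<le> L * norm (x - y)" for x y
    using N_triangle[of "x - y" y] N_triangle[of "y - x" x] N_le_norm[of "x - y"] N_le_norm[of "y - x"]
    by (simp add: norm_minus_commute)
  then have "L-lipschitz_on X N"
    using L by (intro lipschitz_onI) (auto simp: dist_norm)
  then show ?thesis
    by (rule lipschitz_on_continuous_on)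
qed

text \<open>A maximiser \<open>e\<close> of \<open>N\<close> on the unit sphere of \<open>V\<close> is a support point: the first-order condition at \<open>e\<close>
  says that \<open>y \<mapsto> N e * (e \<bullet> y)\<close> is dominated by \<open>N\<close> on \<open>V\<close>. The proof writes \<open>e\<close> as a convex combination
  of \<open>e + v\<close> and \<open>e - s v\<close> with \<open>v\<close> orthogonal to \<open>e\<close>. The Euclidean norm of the second vector exceeds
  \<open>1\<close> only by a term of order \<open>s\<^sup>2\<close>, which disappears against \<open>s\<close> as \<open>s\<close> tends to \<open>0\<close>.\<close>

lemma N_mult_inner_le:
  assumes V: "subspace V" and e: "e \<in> V" "norm e = 1"
    and max: "\<And>y. y \<in> V \<Longrightarrow> N y \<le> N e * norm y"
    and x: "x \<in> V"
  shows "N e * \<bar>e \<bullet> x\<bar> \<le> N x"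
proof (cases "e \<bullet> x = 0")
  case True
  then show ?thesis by (simp add: N_nonneg)
next
  case False
  define c where "c = e \<bullet> x"
  define v where "v = x /\<^sub>R c - e"
  have c: "c \<noteq> 0" using False by (simp add: c_def)
  have v: "v \<in> V" "e \<bullet> v = 0"
    using V e x c by (auto simp: v_def subspace_diff subspace_scale inner_diff_right c_def
        simp flip: norm_eq_sqrt_inner power2_norm_eq_inner)
  have "N e \<le> N (x /\<^sub>R c) + \<epsilon>" if "\<epsilon> > 0" for \<epsilon>
  proof -
    define s where "s = \<epsilon> / (1 + N e * (norm v)\<^sup>2)"
    have den: "1 + N e * (norm v)\<^sup>2 > 0"
      using N_nonneg[of e] by (simp add: add_pos_nonneg)
    have s: "s > 0" "s * (N e * (norm v)\<^sup>2) \<le> \<epsilon>"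
    proof -
      show "s > 0" using den that by (simp add: s_def)
      have "s * (1 + N e * (norm v)\<^sup>2) = \<epsilon>" using den by (simp add: s_def)
      with \<open>s > 0\<close> show "s * (N e * (norm v)\<^sup>2) \<le> \<epsilon>" by (simp add: algebra_simps)
    qed
    have sq: "(norm (e - s *\<^sub>R v))\<^sup>2 = 1 + s\<^sup>2 * (norm v)\<^sup>2"
      unfolding power2_norm_eq_inner using v(2) e(2)
      by (simp add: inner_diff_left inner_diff_right inner_commute norm_eq_1 power2_eq_square)
    have "norm (e - s *\<^sub>R v) \<le> 1 + s\<^sup>2 * (norm v)\<^sup>2 / 2"
      by (rule power2_le_imp_le) (auto simp: sq power2_sum)
    then have 1: "N (e - s *\<^sub>R v) \<le> N e * (1 + s\<^sup>2 * (norm v)\<^sup>2 / 2)"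
      using max[of "e - s *\<^sub>R v"] v e V N_nonneg[of e]
      by (meson mult_left_mono order_trans subspace_diff subspace_scale)
    have "(1 + s) *\<^sub>R e = s *\<^sub>R (x /\<^sub>R c) + (e - s *\<^sub>R v)"
      by (simp add: v_def algebra_simps)
    then have "(1 + s) * N e \<le> s * N (x /\<^sub>R c) + N (e - s *\<^sub>R v)"
      using N_triangle[of "s *\<^sub>R (x /\<^sub>R c)" "e - s *\<^sub>R v"] N_scaleR[of "1 + s" e] N_scaleR[of s "x /\<^sub>R c"] s
      by simp
    with 1 have "s * N e \<le> s * (N (x /\<^sub>R c) + s * (N e * (norm v)\<^sup>2) / 2)"
      by (simp add: algebra_simps power2_eq_square)
    with s have "N e \<le> N (x /\<^sub>R c) + s * (N e * (norm v)\<^sup>2) / 2"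
      by simp
    with s(2) that show ?thesis
      by linarith
  qed
  then have "N e \<le> N (x /\<^sub>R c)"
    by (rule field_le_epsilon)
  then show ?thesis
    using c by (simp add: N_scaleR c_def field_simps)
qed

definition ortho :: "(nat \<Rightarrow> 'a) \<Rightarrow> nat \<Rightarrow> 'a set" where
  "ortho e k = {x. \<forall>i<k. e i \<bullet> x = 0}"

text \<open>Each vector maximises \<open>N\<close> among the unit vectors orthogonal to its predecessors. Such a basis
  diagonalises \<open>N\<close> up to a factor that depends on the dimension only (\<open>greedy_coordinate_le\<close>), and the
  weights \<open>N (e i)\<close> do not increase; it replaces the axes of an inscribed ellipsoid.\<close>

definition greedy :: "(nat \<Rightarrow> 'a) \<Rightarrow> nat \<Rightarrow> bool" where
  "greedy e k \<longleftrightarrow> (\<forall>j<k. norm (e j) = 1 \<and> e j \<in> ortho e j \<and>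
     (\<forall>x\<in>ortho e j. N x \<le> N (e j) * norm x))"

lemma subspace_ortho: "subspace (ortho e k)"
  by (auto simp: subspace_def ortho_def inner_add_right)

lemma greedy_exists: "k \<le> DIM('a) \<Longrightarrow> \<exists>e. greedy e k"
proof (induction k)
  case 0
  then show ?case by (simp add: greedy_def)
next
  case (Suc k)
  then obtain e where e: "greedy e k"
    by auto
  define X where "X = sphere 0 1 \<inter> ortho e k"
  have "compact X"
    unfolding X_def by (intro compact_Int_closed compact_sphere closed_subspace subspace_ortho)
  moreover have "X \<noteq> {}"
  proof -
    have "dim (e ` {..<k}) \<le> card (e ` {..<k})"
      by (rule dim_le_card') auto
    also have "\<dots> \<le> k"
      using card_image_le[of "{..<k}" e] by simp
    also have "\<dots> < DIM('a)"
      using Suc.prems by simp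
    finally obtain x where x: "x \<noteq> 0" "\<And>y. y \<in> span (e ` {..<k}) \<Longrightarrow> orthogonal x y"
      using orthogonal_to_subspace_exists by blast
    then have "e i \<bullet> x = 0" if "i < k" for i
      using that by (metis imageI inner_commute lessThan_iff orthogonal_def span_base)
    then have "x /\<^sub>R norm x \<in> X"
      using x(1) by (simp add: X_def ortho_def)
    then show ?thesis by blast
  qed
  ultimately obtain u where u: "u \<in> X" "\<And>x. x \<in> X \<Longrightarrow> N x \<le> N u"
    using continuous_attains_sup[of X N] continuous_on_N by blast
  define f where "f = e(k := u)"
  have f: "ortho f j = ortho e j" if "j \<le> k" for j
    using that by (auto simp: ortho_def f_def)
  have "N x \<le> N u * norm x" if "x \<in> ortho e k" for x
  proof (cases "x = 0")
    case True
    then show ?thesis using N_le_norm[of 0] by simp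
  next
    case False
    then have "x /\<^sub>R norm x \<in> X"
      using that subspace_ortho[of e k] by (simp add: X_def subspace_scale)
    from u(2)[OF this] show ?thesis
      using False by (simp add: N_scaleR field_simps)
  qed
  then have "greedy f (Suc k)"
    using e u(1) by (auto simp: greedy_def less_Suc_eq f) (auto simp: f_def X_def)
  then show ?case by blast
qed

definition residual :: "(nat \<Rightarrow> 'a) \<Rightarrow> nat \<Rightarrow> 'a \<Rightarrow> 'a" where
  "residual e k x = x - (\<Sum>i<k. (e i \<bullet> x) *\<^sub>R e i)"

lemma greedy_inner:
  assumes "greedy e k" "i < k" "j < k"
  shows "e i \<bullet> e j = (if i = j then 1 else 0)"
  using assms by (cases i j rule: linorder_cases)
    (auto simp: greedy_def ortho_def norm_eq_1 inner_commute)

lemma residual_in_ortho: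
  assumes "greedy e k" "j \<le> k"
  shows "residual e j x \<in> ortho e j"
proof -
  have "e i \<bullet> (\<Sum>l<j. (e l \<bullet> x) *\<^sub>R e l) = e i \<bullet> x" if "i < j" for i
  proof -
    have "e i \<bullet> (\<Sum>l<j. (e l \<bullet> x) *\<^sub>R e l) = (\<Sum>l<j. if l = i then e i \<bullet> x else 0)"
      unfolding inner_sum_right using assms that
      by (intro sum.cong refl) (auto simp: greedy_inner[OF assms(1)])
    with that show ?thesis by simp
  qed
  then show ?thesis
    by (simp add: ortho_def residual_def inner_diff_right)
qed

lemma residual_Suc: "residual e (Suc j) x = residual e j x - (e j \<bullet> x) *\<^sub>R e j"
  by (simp add: residual_def)

lemma inner_residual:
  assumes "greedy e k" "j < k"
  shows "e j \<bullet> residual e j x = e j \<bullet> x"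
  using assms by (simp add: residual_def inner_diff_right inner_sum_right greedy_inner[OF assms(1)])

text \<open>Removing one coordinate at most doubles \<open>N\<close>, because \<open>N_mult_inner_le\<close> bounds the removed part by
  the vector it is removed from.\<close>

lemma N_residual_le:
  assumes "greedy e k" "j \<le> k"
  shows "N (residual e j x) \<le> 2 ^ j * N x"
  using assms(2)
proof (induction j)
  case 0
  then show ?case by (simp add: residual_def)
next
  case (Suc j)
  have "N (e j) * \<bar>e j \<bullet> residual e j x\<bar> \<le> N (residual e j x)"
    using assms(1) Suc.prems
    by (intro N_mult_inner_le[OF subspace_ortho[of e j]] residual_in_ortho[OF assms(1)])
      (auto simp: greedy_def)
  moreover have "N (residual e (Suc j) x) \<le> N (residual e j x) + \<bar>e j \<bullet> residual e j x\<bar> * N (e j)"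
    unfolding residual_Suc using N_diff[of "residual e j x" "(e j \<bullet> x) *\<^sub>R e j"] Suc.prems
    by (simp add: N_scaleR inner_residual[OF assms(1)])
  moreover have "N (residual e j x) \<le> 2 ^ j * N x"
    using Suc by simp
  ultimately show ?case
    by (simp add: mult.commute)
qed

lemma greedy_coordinate_le:
  assumes "greedy e k" "j < k"
  shows "N (e j) * \<bar>e j \<bullet> x\<bar> \<le> 2 ^ j * N x"
proof -
  have "N (e j) * \<bar>e j \<bullet> residual e j x\<bar> \<le> N (residual e j x)"
    using assms
    by (intro N_mult_inner_le[OF subspace_ortho[of e j]] residual_in_ortho[OF assms(1)])
      (auto simp: greedy_def)
  also have "\<dots> \<le> 2 ^ j * N x"
    using assms by (intro N_residual_le) auto
  finally show ?thesis
    using assms by (simp add: inner_residual[OF assms(1)])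
qed

lemma norm_residual_le:
  assumes "greedy e k" "j \<le> k"
  shows "norm (residual e j x) \<le> norm x"
  using assms(2)
proof (induction j)
  case 0
  then show ?case by (simp add: residual_def)
next
  case (Suc j)
  let ?r = "residual e j x" and ?u = "residual e (Suc j) x"
  have r: "?r = ?u + (e j \<bullet> x) *\<^sub>R e j"
    by (simp add: residual_Suc)
  have "e j \<bullet> ?u = 0"
    using residual_in_ortho[OF assms(1) Suc.prems, of x] by (simp add: ortho_def)
  then have "(norm ?r)\<^sup>2 = (norm ?u)\<^sup>2 + (norm ((e j \<bullet> x) *\<^sub>R e j))\<^sup>2"
    unfolding r by (intro norm_add_Pythagorean) (simp add: orthogonal_def inner_commute)
  then have "(norm ?u)\<^sup>2 \<le> (norm ?r)\<^sup>2"
    by simp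
  then have "norm ?u \<le> norm ?r"
    by (rule power2_le_imp_le) simp
  with Suc show ?case by simp
qed

lemma greedy_complete:
  assumes "greedy e DIM('a)" "x \<in> ortho e DIM('a)"
  shows "x = 0"
proof -
  have inj: "inj_on e {..<DIM('a)}"
    by (rule inj_onI) (metis assms(1) greedy_inner lessThan_iff zero_neq_one)
  have "pairwise orthogonal (e ` {..<DIM('a)})"
    by (auto simp: pairwise_def orthogonal_def greedy_inner[OF assms(1)])
  moreover have "0 \<notin> e ` {..<DIM('a)}"
    using assms(1) by (auto simp: greedy_def)
  ultimately have "independent (e ` {..<DIM('a)})"
    by (rule pairwise_orthogonal_independent)
  then have "UNIV \<subseteq> span (e ` {..<DIM('a)})"
    using inj by (intro card_ge_dim_independent) (auto simp: card_image)
  then have "orthogonal x x"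
    using assms(2) by (intro orthogonal_to_span[of x "e ` {..<DIM('a)}"])
      (auto simp: orthogonal_def ortho_def inner_commute)
  then show ?thesis
    by (simp add: orthogonal_def)
qed

text \<open>In a greedy basis, the entries of \<open>A\<close> that lead from the coordinates \<open>\<ge> j\<close> back to a coordinate
  \<open>i \<le> j\<close> are of order \<open>q\<close>: passing from \<open>N\<close> to the Euclidean norm costs \<open>1 / N (e i)\<close>, and this is paid by
  \<open>N y \<le> N (e i)\<close>, which holds because \<open>y\<close> is still orthogonal to the predecessors of \<open>e i\<close>.\<close>

lemma greedy_drift_le:
  assumes "greedy e k" "j < k" "y \<in> ortho e j" "norm y \<le> 1"
    and A: "\<And>x. N (app A x) \<le> q * N x" and "0 \<le> q"
  shows "norm (app A y - residual e (Suc j) (app A y)) \<le> real k * 2 ^ k * q"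
proof -
  have coord: "norm ((e i \<bullet> app A y) *\<^sub>R e i) \<le> 2 ^ k * q" if "i < Suc j" for i
  proof -
    have ik: "i < k" using that assms(2) by simp
    have ei: "norm (e i) = 1" using assms(1) ik by (simp add: greedy_def)
    have pos: "0 < N (e i)" using norm_le_N[of "e i"] ei by linarith
    have mono: "y \<in> ortho e i" using assms(3) that by (auto simp: ortho_def)
    have "N (e i) * \<bar>e i \<bullet> app A y\<bar> \<le> 2 ^ i * N (app A y)"
      by (rule greedy_coordinate_le[OF assms(1) ik])
    also have "\<dots> \<le> 2 ^ i * (q * N y)"
      by (intro mult_left_mono A) auto
    also have "\<dots> \<le> 2 ^ k * (q * (N (e i) * 1))"
    proof -
      have "N y \<le> N (e i) * norm y"
        using assms(1) ik mono by (simp add: greedy_def)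
      also have "\<dots> \<le> N (e i) * 1"
        using assms(4) pos by (intro mult_left_mono) auto
      finally show ?thesis
        using ik \<open>0 \<le> q\<close> N_nonneg by (intro mult_mono) (auto intro!: power_increasing)
    qed
    finally have "N (e i) * \<bar>e i \<bullet> app A y\<bar> \<le> N (e i) * (2 ^ k * q)"
      by (simp add: mult.commute mult.left_commute)
    with pos ei show ?thesis by simp
  qed
  have "norm (\<Sum>i<Suc j. (e i \<bullet> app A y) *\<^sub>R e i) \<le> (\<Sum>i<Suc j. 2 ^ k * q)"
    by (intro sum_norm_le coord) auto
  also have "\<dots> = real (Suc j) * (2 ^ k * q)"
    by simp
  also have "\<dots> \<le> real k * (2 ^ k * q)"
    using assms(2) \<open>0 \<le> q\<close> by (intro mult_right_mono) auto
  finally show ?thesis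
    by (simp add: residual_def mult.assoc del: sum.lessThan_Suc)
qed

text \<open>The constant is independent of \<open>N\<close>; this is what makes all later estimates uniform. Apart from
  terms that contain a factor \<open>q\<close>, every matrix pushes a vector of \<open>ortho e j\<close> into \<open>ortho e (Suc j)\<close>, and
  after \<open>DIM('a)\<close> such steps no coordinate is left. Hence every term of the product contains a factor \<open>q\<close>.
  This is a form of Bochi's inequality for the joint spectral radius.\<close>

theorem norm_prod_contractions_le:
  assumes len: "length As = DIM('a)" and q: "0 \<le> q"
    and norm1: "\<And>A. A \<in> set As \<Longrightarrow> norm A \<le> 1"
    and Nq: "\<And>A x. A \<in> set As \<Longrightarrow> N (app A x) \<le> q * N x"
  shows "norm (prod_list As) \<le> (real DIM('a))\<^sup>2 * 2 ^ DIM('a) * q"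
proof -
  let ?d = "DIM('a)"
  obtain e where e: "greedy e ?d"
    using greedy_exists by blast
  \<comment> \<open>\<open>y\<close> collects the paths whose coordinate index has strictly increased in every step, \<open>z\<close> the rest.\<close>
  have split: "\<exists>y z. app (prod_list Bs) x = y + z \<and> y \<in> ortho e (length Bs) \<and> norm y \<le> 1 \<and>
      norm z \<le> real (length Bs) * (real ?d * 2 ^ ?d * q)"
    if "length Bs \<le> ?d" "set Bs \<subseteq> set As" "norm x = 1" for Bs x
    using that(1,2)
  proof (induction Bs)
    case Nil
    show ?case
      by (rule exI[of _ x], rule exI[of _ 0]) (simp add: ortho_def that)
  next
    case (Cons A Bs)
    then obtain y z where yz: "app (prod_list Bs) x = y + z" "y \<in> ortho e (length Bs)" "norm y \<le> 1"
      "norm z \<le> real (length Bs) * (real ?d * 2 ^ ?d * q)"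
      by auto
    let ?y = "residual e (Suc (length Bs)) (app A y)"
    let ?z = "(app A y - ?y) + app A z"
    have A: "norm A \<le> 1" "\<And>x. N (app A x) \<le> q * N x"
      using Cons.prems norm1 Nq by auto
    have contr: "norm (app A v) \<le> norm v" for v
      using norm_app[of A v] A(1) mult_right_mono[OF A(1) norm_ge_zero[of v]] by simp
    have "norm (app A y - ?y) \<le> real ?d * 2 ^ ?d * q"
      using greedy_drift_le[OF e _ yz(2,3) A(2) q] Cons.prems by simp
    then have "norm ?z \<le> real ?d * 2 ^ ?d * q + norm z"
      using norm_triangle_ineq[of "app A y - ?y" "app A z"] contr[of z] by linarith
    then have "norm ?z \<le> real (length (A # Bs)) * (real ?d * 2 ^ ?d * q)"
      using yz(4) by (simp add: algebra_simps)
    moreover have "norm ?y \<le> 1"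
      using norm_residual_le[OF e, of "Suc (length Bs)" "app A y"] contr[of y] yz(3) Cons.prems(1) by simp
    moreover have "?y \<in> ortho e (length (A # Bs))"
      using residual_in_ortho[OF e Cons.prems(1)] by simp
    moreover have "app (prod_list (A # Bs)) x = ?y + ?z"
      by (simp add: app_mult yz(1) app.add_right)
    ultimately show ?case by blast
  qed
  show ?thesis
  proof (rule norm_endo_le)
    fix x :: 'a assume "norm x = 1"
    from split[OF _ _ this, of As] obtain y z where yz: "app (prod_list As) x = y + z"
      "y \<in> ortho e ?d" "norm z \<le> real ?d * (real ?d * 2 ^ ?d * q)"
      using len by auto
    moreover have "y = 0"
      using greedy_complete[OF e yz(2)] .
    ultimately show "norm (app (prod_list As) x) \<le> (real ?d)\<^sup>2 * 2 ^ ?d * q"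
      by (simp add: power2_eq_square mult.assoc)
  qed (use q in simp)
qed

end

section \<open>Words of timed endomorphisms\<close>

text \<open>A letter is a transition matrix together with the time it takes. The head of a word is the latest
  factor in time, so that \<open>wprod\<close> is an ordinary product.\<close>

type_synonym 'a timed = "real \<times> 'a endo"

definition dur :: "'a::euclidean_space timed list \<Rightarrow> real" where
  "dur w = sum_list (map fst w)"

definition wprod :: "'a::euclidean_space timed list \<Rightarrow> 'a endo" where
  "wprod w = prod_list (map snd w)"

lemma dur_simps [simp]:
  "dur [] = 0" "dur (p # w) = fst p + dur w" "dur (u @ v) = dur u + dur v"
  by (simp_all add: dur_def)

lemma wprod_simps [simp]:
  "wprod [] = 1" "wprod (p # w) = snd p * wprod w" "wprod (u @ v) = wprod u * wprod v"
  by (simp_all add: wprod_def)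

lemma dur_nonneg:
  assumes "w \<in> lists P" "\<And>p. p \<in> P \<Longrightarrow> 0 \<le> fst p"
  shows "0 \<le> dur w"
  using assms(1) by induction (auto intro: add_nonneg_nonneg assms(2))

text \<open>The constant enters as \<open>exp c\<close>, so that constants add up when words are concatenated.\<close>

definition growth_bounded :: "'a::euclidean_space timed set \<Rightarrow> real \<Rightarrow> real \<Rightarrow> bool" where
  "growth_bounded P \<omega> c \<longleftrightarrow> (\<forall>w\<in>lists P. norm (wprod w) \<le> exp (\<omega> * dur w + c))"

lemma growth_boundedD: "growth_bounded P \<omega> c \<Longrightarrow> w \<in> lists P \<Longrightarrow> norm (wprod w) \<le> exp (\<omega> * dur w + c)"
  by (simp add: growth_bounded_def)

lemma growth_bounded_nonneg: "growth_bounded P \<omega> c \<Longrightarrow> 0 \<le> c"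
  using growth_boundedD[of P \<omega> c "[]"] by simp

lemma growth_bounded_mono:
  assumes "growth_bounded P \<omega> c" "\<omega> \<le> \<omega>'" "c \<le> c'" "\<And>p. p \<in> P \<Longrightarrow> 0 \<le> fst p"
  shows "growth_bounded P \<omega>' c'"
  unfolding growth_bounded_def
proof
  fix w assume w: "w \<in> lists P"
  have "norm (wprod w) \<le> exp (\<omega> * dur w + c)"
    using assms(1) w by (rule growth_boundedD)
  also have "\<dots> \<le> exp (\<omega>' * dur w + c')"
    using assms(2,3) dur_nonneg[OF w assms(4)] by (auto intro!: add_mono mult_right_mono)
  finally show "norm (wprod w) \<le> exp (\<omega>' * dur w + c')" .
qed

lemma growth_bounded_submultiplicative:
  assumes "\<And>p. p \<in> P \<Longrightarrow> norm (snd p) \<le> exp (\<omega> * fst p)"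
  shows "growth_bounded P \<omega> 0"
  unfolding growth_bounded_def
proof
  fix w assume "w \<in> lists P"
  then show "norm (wprod w) \<le> exp (\<omega> * dur w + 0)"
  proof induction
    case (Cons p w)
    have "norm (wprod (p # w)) \<le> norm (snd p) * norm (wprod w)"
      by (simp add: norm_mult_ineq)
    also have "\<dots> \<le> exp (\<omega> * fst p) * exp (\<omega> * dur w + 0)"
      using Cons assms by (intro mult_mono) auto
    finally show ?case
      by (simp add: exp_add ring_distribs)
  qed simp
qed

section \<open>The norm adapted to a set of words\<close>

text \<open>The supremum over all continuations makes every word of duration \<open>t\<close> expand this norm by at most
  \<open>exp (\<omega> * t)\<close>, without a multiplicative constant.\<close>

definition word_norm :: "'a::euclidean_space timed set \<Rightarrow> real \<Rightarrow> 'a \<Rightarrow> real" where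
  "word_norm P \<omega> x = (SUP w\<in>lists P. exp (- \<omega> * dur w) * norm (app (wprod w) x))"

context
  fixes P :: "'a::euclidean_space timed set" and \<omega> c :: real
  assumes bounded: "growth_bounded P \<omega> c"
begin

lemma word_norm_term_le:
  assumes "w \<in> lists P"
  shows "exp (- \<omega> * dur w) * norm (app (wprod w) x) \<le> exp c * norm x"
proof -
  have "exp (- \<omega> * dur w) * norm (app (wprod w) x)
      \<le> exp (- \<omega> * dur w) * (exp (\<omega> * dur w + c) * norm x)"
    using growth_boundedD[OF bounded assms]
    by (intro mult_left_mono order_trans[OF norm_app] mult_right_mono) auto
  also have "\<dots> = exp c * norm x"
    by (simp add: exp_add exp_minus field_simps)
  finally show ?thesis .
qed

lemma word_norm_upper:
  assumes "w \<in> lists P"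
  shows "exp (- \<omega> * dur w) * norm (app (wprod w) x) \<le> word_norm P \<omega> x"
  unfolding word_norm_def
  by (rule cSUP_upper[OF assms]) (rule bdd_aboveI2, rule word_norm_term_le)

lemma word_norm_least:
  assumes "\<And>w. w \<in> lists P \<Longrightarrow> exp (- \<omega> * dur w) * norm (app (wprod w) x) \<le> b"
  shows "word_norm P \<omega> x \<le> b"
  unfolding word_norm_def using assms by (intro cSUP_least) auto

lemma equivalent_norm_word_norm: "equivalent_norm (word_norm P \<omega>) (exp c)"
proof
  show "word_norm P \<omega> (x + y) \<le> word_norm P \<omega> x + word_norm P \<omega> y" for x y
  proof (rule word_norm_least)
    fix w assume w: "w \<in> lists P"
    have "exp (- \<omega> * dur w) * norm (app (wprod w) (x + y)) \<le>
      exp (- \<omega> * dur w) * (norm (app (wprod w) x) + norm (app (wprod w) y))"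
      by (intro mult_left_mono) (auto simp: app.add_right intro: norm_triangle_ineq)
    also have "\<dots> \<le> word_norm P \<omega> x + word_norm P \<omega> y"
      using word_norm_upper[OF w, of x] word_norm_upper[OF w, of y] by (simp add: ring_distribs)
    finally show "exp (- \<omega> * dur w) * norm (app (wprod w) (x + y)) \<le> word_norm P \<omega> x + word_norm P \<omega> y" .
  qed
  have le: "word_norm P \<omega> (r *\<^sub>R x) \<le> \<bar>r\<bar> * word_norm P \<omega> x" for r x
  proof (rule word_norm_least)
    fix w assume w: "w \<in> lists P"
    show "exp (- \<omega> * dur w) * norm (app (wprod w) (r *\<^sub>R x)) \<le> \<bar>r\<bar> * word_norm P \<omega> x"
      using mult_left_mono[OF word_norm_upper[OF w, of x], of "\<bar>r\<bar>"]
      by (simp add: app.scaleR_right mult.left_commute)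
  qed
  show "word_norm P \<omega> (r *\<^sub>R x) = \<bar>r\<bar> * word_norm P \<omega> x" for r x
  proof (cases "r = 0")
    case True
    have "0 \<le> word_norm P \<omega> 0"
      using word_norm_upper[of "[]" 0] by simp
    moreover have "word_norm P \<omega> 0 \<le> 0"
      using word_norm_least[of 0 0] by (simp add: app.zero_right)
    ultimately show ?thesis using True by simp
  next
    case False
    have "\<bar>r\<bar> * word_norm P \<omega> x = \<bar>r\<bar> * word_norm P \<omega> (inverse r *\<^sub>R (r *\<^sub>R x))"
      using False by simp
    also have "\<dots> \<le> \<bar>r\<bar> * (\<bar>inverse r\<bar> * word_norm P \<omega> (r *\<^sub>R x))"
      by (intro mult_left_mono le) auto
    also have "\<dots> = word_norm P \<omega> (r *\<^sub>R x)"
      using False by simp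
    finally show ?thesis using le[of r x] by simp
  qed
  show "norm x \<le> word_norm P \<omega> x" for x
    using word_norm_upper[of "[]" x] by simp
  show "word_norm P \<omega> x \<le> exp c * norm x" for x
    by (intro word_norm_least word_norm_term_le)
qed

lemma word_norm_wprod_le:
  assumes u: "u \<in> lists P"
  shows "word_norm P \<omega> (app (wprod u) x) \<le> exp (\<omega> * dur u) * word_norm P \<omega> x"
proof (rule word_norm_least)
  fix w assume w: "w \<in> lists P"
  have "exp (- \<omega> * dur w) * norm (app (wprod w) (app (wprod u) x)) =
    exp (\<omega> * dur u) * (exp (- \<omega> * dur (w @ u)) * norm (app (wprod (w @ u)) x))"
    by (simp add: app_mult ring_distribs exp_add[symmetric] mult.assoc[symmetric])
  also have "\<dots> \<le> exp (\<omega> * dur u) * word_norm P \<omega> x"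
    using u w by (intro mult_left_mono word_norm_upper) auto
  finally show "exp (- \<omega> * dur w) * norm (app (wprod w) (app (wprod u) x)) \<le>
    exp (\<omega> * dur u) * word_norm P \<omega> x" .
qed

end

text \<open>The adapted norm of \<open>P\<close> is within a factor \<open>exp c\<close> of the Euclidean norm. Hence a perturbation that is
  small compared with \<open>exp (- c)\<close> changes the one-step factors of the adapted norm only slightly, and
  one-step factors multiply along words of any length. The first alternative serves letters of long
  duration, which are not close to letters of \<open>P\<close>.\<close>

lemma growth_bounded_perturb:
  assumes P: "growth_bounded P \<omega> c"
    and P': "\<And>s A'. (s, A') \<in> P' \<Longrightarrow> norm A' \<le> exp (\<omega>' * s - c) \<or>
      (\<exists>A. (s, A) \<in> P \<and> exp (\<omega> * s) + exp c * norm (A' - A) \<le> exp (\<omega>' * s))"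
  shows "growth_bounded P' \<omega>' c"
  unfolding growth_bounded_def
proof
  let ?N = "word_norm P \<omega>"
  interpret equivalent_norm ?N "exp c"
    by (rule equivalent_norm_word_norm[OF P])
  have step: "?N (app A' x) \<le> exp (\<omega>' * s) * ?N x" if "(s, A') \<in> P'" for s A' x
    using P'[OF that]
  proof (elim disjE exE conjE)
    assume "norm A' \<le> exp (\<omega>' * s - c)"
    then have "norm A' * norm x \<le> exp (\<omega>' * s - c) * ?N x"
      by (intro mult_mono norm_le_N) auto
    with norm_app[of A' x] have "norm (app A' x) \<le> exp (\<omega>' * s - c) * ?N x"
      by linarith
    then have "exp c * norm (app A' x) \<le> exp c * (exp (\<omega>' * s - c) * ?N x)"
      by (rule mult_left_mono) simp
    with N_le_norm[of "app A' x"] show ?thesis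
      by (simp add: exp_diff)
  next
    fix A assume A: "(s, A) \<in> P" "exp (\<omega> * s) + exp c * norm (A' - A) \<le> exp (\<omega>' * s)"
    have "?N (app A' x) \<le> ?N (app A x) + ?N (app (A' - A) x)"
      using N_triangle[of "app A x" "app (A' - A) x"] by (simp flip: app.add_left)
    also have "?N (app A x) \<le> exp (\<omega> * s) * ?N x"
      using word_norm_wprod_le[OF P, of "[(s, A)]" x] A(1) by simp
    also have "?N (app (A' - A) x) \<le> exp c * (norm (A' - A) * norm x)"
      using N_le_norm[of "app (A' - A) x"]
      by (rule order_trans) (intro mult_left_mono norm_app exp_ge_zero)
    also have "exp c * (norm (A' - A) * norm x) \<le> exp c * (norm (A' - A) * ?N x)"
      by (intro mult_left_mono norm_le_N) auto
    also have "exp (\<omega> * s) * ?N x + exp c * (norm (A' - A) * ?N x) \<le> exp (\<omega>' * s) * ?N x"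
      using mult_right_mono[OF A(2) N_nonneg[of x]] by (simp add: ring_distribs mult.assoc)
    finally show ?thesis by simp
  qed
  fix w assume w: "w \<in> lists P'"
  have "?N (app (wprod w) x) \<le> exp (\<omega>' * dur w) * ?N x" for x
    using w
  proof induction
    case (Cons p w)
    obtain s A' where p: "p = (s, A')" by force
    have "?N (app (wprod (p # w)) x) \<le> exp (\<omega>' * s) * ?N (app (wprod w) x)"
      using step[of s A' "app (wprod w) x"] Cons.hyps p by (simp add: app_mult)
    also have "\<dots> \<le> exp (\<omega>' * s) * (exp (\<omega>' * dur w) * ?N x)"
      by (intro mult_left_mono Cons.IH) auto
    finally show ?case
      by (simp add: p exp_add ring_distribs mult.assoc)
  qed simp
  then have "norm (app (wprod w) x) \<le> exp (\<omega>' * dur w) * (exp c * norm x)" for x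
    by (meson norm_le_N N_le_norm order_trans mult_left_mono exp_ge_zero)
  then show "norm (wprod w) \<le> exp (\<omega>' * dur w + c)"
    by (intro norm_endo_le) (simp, metis exp_add mult_1_right)
qed

section \<open>A rate-improving step\<close>

lemma split_prefix:
  fixes w :: "'a::euclidean_space timed list"
  assumes "\<And>p. p \<in> set w \<Longrightarrow> fst p \<le> h" "0 \<le> h" "h \<le> dur w"
  shows "\<exists>u v. w = u @ v \<and> h \<le> dur u \<and> dur u \<le> 2 * h"
proof -
  have "\<exists>u v. w = u @ v \<and> b \<le> dur u \<and> dur u \<le> b + h" if "0 \<le> b" "b \<le> dur w" for b
    using that assms(1)
  proof (induction w arbitrary: b)
    case Nil
    then show ?case using assms(2) by auto
  next
    case (Cons p w)
    show ?case
    proof (cases "b \<le> fst p")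
      case True
      then show ?thesis
        using Cons.prems(1) Cons.prems(3)[of p]
        by (intro exI[of _ "[p]"] exI[of _ w]) auto
    next
      case False
      then obtain u v where "w = u @ v" "b - fst p \<le> dur u" "dur u \<le> b - fst p + h"
        using Cons.IH[of "b - fst p"] Cons.prems by auto
      then show ?thesis
        by (intro exI[of _ "p # u"] exI[of _ v]) auto
    qed
  qed
  from this[of h] assms show ?thesis by simp
qed

text \<open>Cutting greedily as soon as a piece has reached duration \<open>h\<close> overshoots by at most one letter, so
  \<open>2 * h\<close> is consumed per piece.\<close>

lemma split_word:
  fixes w :: "'a::euclidean_space timed list"
  assumes "\<And>p. p \<in> set w \<Longrightarrow> fst p \<le> h" "0 \<le> h" "2 * h * Suc n \<le> dur w"
  shows "\<exists>ws. length ws = Suc n \<and> concat ws = w \<and> (\<forall>u\<in>set ws. h \<le> dur u)"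
  using assms(1,3)
proof (induction n arbitrary: w)
  case 0
  then show ?case
    using assms(2) by (intro exI[of _ "[w]"]) auto
next
  case (Suc n)
  have "h \<le> dur w"
    using Suc.prems(2) assms(2) by (simp add: algebra_simps) (smt (verit) mult_nonneg_nonneg of_nat_0_le_iff)
  from split_prefix[OF Suc.prems(1) assms(2) this]
  obtain u v where uv: "w = u @ v" "h \<le> dur u" "dur u \<le> 2 * h"
    by blast
  then have "2 * h * Suc n \<le> dur v"
    using Suc.prems(2) by (simp add: algebra_simps)
  with Suc.IH[of v] Suc.prems(1) uv
  obtain ws where "length ws = Suc n" "concat ws = v" "\<forall>u\<in>set ws. h \<le> dur u"
    by auto
  with uv show ?case
    by (intro exI[of _ "u # ws"]) auto
qed

lemma prod_list_normalized:
  fixes \<beta> c :: real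
  shows "prod_list (map (\<lambda>u. exp (- (\<beta> * dur u + c)) *\<^sub>R wprod u) ws) =
    exp (- (\<beta> * dur (concat ws) + length ws * c)) *\<^sub>R wprod (concat ws)"
proof (induction ws)
  case (Cons u ws)
  then show ?case
    by (simp add: exp_add[symmetric] algebra_simps)
qed simp

definition bochi_const :: "'a::euclidean_space itself \<Rightarrow> real" where
  "bochi_const _ = (real DIM('a))\<^sup>2 * 2 ^ DIM('a)"

lemma bochi_const_ge_1: "1 \<le> bochi_const TYPE('a::euclidean_space)"
proof -
  have "1 * 1 \<le> (real DIM('a))\<^sup>2 * 2 ^ DIM('a)"
    using DIM_positive[where 'a='a] by (intro mult_mono) (auto simp: one_le_power Suc_le_eq)
  then show ?thesis by (simp add: bochi_const_def)
qed

text \<open>If no letter lasts longer than the fraction \<open>1 / (2 * d)\<close> of the word, the word splits into \<open>d\<close> pieces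
  of at least that duration, and \<open>norm_prod_contractions_le\<close>, applied to the norm adapted to \<open>\<omega>\<close>, gains the
  factor \<open>exp (- (\<beta> - \<omega>) * h)\<close> of one piece. Otherwise a single long letter already grows at rate \<open>\<omega>\<close> and
  gives the same gain.\<close>

lemma growth_bounded_improve:
  fixes P :: "'a::euclidean_space timed set"
  defines "d \<equiv> real DIM('a)"
  assumes nonneg: "\<And>p. p \<in> P \<Longrightarrow> 0 \<le> fst p"
    and \<beta>: "growth_bounded P \<beta> c" and \<omega>: "growth_bounded P \<omega> C"
    and letters: "\<And>p. p \<in> P \<Longrightarrow> norm (snd p) \<le> exp (\<omega> * fst p + c0)"
    and "\<omega> \<le> \<beta>" "0 \<le> c0"
  shows "growth_bounded P (\<beta> - (\<beta> - \<omega>) / (2 * d)) ((d + 2) * c + c0 + ln (bochi_const TYPE('a)))"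
  unfolding growth_bounded_def
proof
  fix w assume w: "w \<in> lists P"
  have d: "d \<ge> 1"
    using DIM_positive[where 'a='a] by (simp add: d_def Suc_le_eq)
  have c: "0 \<le> c" using \<beta> by (rule growth_bounded_nonneg)
  have b: "0 \<le> ln (bochi_const TYPE('a))" "0 < bochi_const TYPE('a)"
    using bochi_const_ge_1[where 'a='a] by (auto intro: ln_ge_zero less_le_trans[OF zero_less_one])
  define h where "h = dur w / (2 * d)"
  have w0: "0 \<le> dur w" using w nonneg by (rule dur_nonneg)
  then have h: "0 \<le> h" "2 * h * d = dur w" using d by (auto simp: h_def)
  have target: "\<beta> * dur w - (\<beta> - \<omega>) * h = (\<beta> - (\<beta> - \<omega>) / (2 * d)) * dur w"
    by (simp add: h_def algebra_simps diff_divide_distrib)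
  have "norm (wprod w) \<le> exp (\<beta> * dur w - (\<beta> - \<omega>) * h + ((d + 2) * c + c0 + ln (bochi_const TYPE('a))))"
  proof (cases "\<forall>p\<in>set w. fst p \<le> h")
    case True
    obtain n where n: "DIM('a) = Suc n"
      using DIM_positive[where 'a='a] gr0_implies_Suc by blast
    obtain ws where ws: "length ws = DIM('a)" "concat ws = w" "\<And>u. u \<in> set ws \<Longrightarrow> h \<le> dur u"
      using split_word[of w h n] True h n by (auto simp: d_def)
    have ws_P: "u \<in> lists P" if "u \<in> set ws" for u
      using that w ws(2) by auto
    interpret equivalent_norm "word_norm P \<omega>" "exp C"
      by (rule equivalent_norm_word_norm[OF \<omega>])
    let ?f = "\<lambda>u. exp (- (\<beta> * dur u + c)) *\<^sub>R wprod u"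
    have "norm (prod_list (map ?f ws)) \<le> bochi_const TYPE('a) * exp (- (\<beta> - \<omega>) * h)"
      unfolding bochi_const_def
    proof (rule norm_prod_contractions_le)
      fix A assume "A \<in> set (map ?f ws)"
      then obtain u where u: "u \<in> set ws" "A = ?f u" by auto
      have "norm A \<le> exp (- (\<beta> * dur u + c)) * exp (\<beta> * dur u + c)"
        unfolding u(2) using growth_boundedD[OF \<beta> ws_P[OF u(1)]] by simp
      then show "norm A \<le> 1"
        by (simp flip: exp_add)
      fix x
      have "word_norm P \<omega> (app A x) = exp (- (\<beta> * dur u + c)) * word_norm P \<omega> (app (wprod u) x)"
        unfolding u(2) by (simp add: app.scaleR_left N_scaleR)
      also have "\<dots> \<le> exp (- (\<beta> * dur u + c)) * (exp (\<omega> * dur u) * word_norm P \<omega> x)"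
        by (intro mult_left_mono word_norm_wprod_le[OF \<omega> ws_P[OF u(1)]]) auto
      also have "\<dots> = exp (- (\<beta> - \<omega>) * dur u - c) * word_norm P \<omega> x"
        by (simp add: algebra_simps flip: exp_add mult.assoc)
      also have "\<dots> \<le> exp (- (\<beta> - \<omega>) * h) * word_norm P \<omega> x"
        using mult_left_mono[OF ws(3)[OF u(1)], of "\<beta> - \<omega>"] \<open>\<omega> \<le> \<beta>\<close> c N_nonneg
        by (intro mult_right_mono) (auto simp: algebra_simps)
      finally show "word_norm P \<omega> (app A x) \<le> exp (- (\<beta> - \<omega>) * h) * word_norm P \<omega> x" .
    qed (use ws in auto)
    then have "exp (- (\<beta> * dur w + d * c)) * norm (wprod w) \<le> bochi_const TYPE('a) * exp (- (\<beta> - \<omega>) * h)"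
      unfolding prod_list_normalized[of \<beta> c ws] ws d_def by simp
    from mult_left_mono[OF this, of "exp (\<beta> * dur w + d * c)"]
    have "norm (wprod w) \<le> exp (\<beta> * dur w + d * c) * (exp (ln (bochi_const TYPE('a))) * exp (- (\<beta> - \<omega>) * h))"
      using b(2) by (simp add: mult.assoc[symmetric] exp_add[symmetric])
    also have "\<dots> \<le> exp (\<beta> * dur w - (\<beta> - \<omega>) * h + ((d + 2) * c + c0 + ln (bochi_const TYPE('a))))"
      using c \<open>0 \<le> c0\<close> unfolding exp_add[symmetric] by (simp add: algebra_simps)
    finally show ?thesis .
  next
    case False
    then obtain p where p: "p \<in> set w" "h < fst p" by force
    then obtain u v where uv: "w = u @ p # v" by (meson split_list)
    have "norm (wprod w) \<le> norm (wprod u) * (norm (snd p) * norm (wprod v))"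
      unfolding uv by (simp add: norm_mult_ineq order_trans[OF norm_mult_ineq mult_left_mono])
    also have "\<dots> \<le> exp (\<beta> * dur u + c) * (exp (\<omega> * fst p + c0) * exp (\<beta> * dur v + c))"
      using w uv by (intro mult_mono growth_boundedD[OF \<beta>] letters) auto
    also have "\<dots> = exp (\<beta> * dur w - (\<beta> - \<omega>) * fst p + (2 * c + c0))"
      unfolding uv exp_add[symmetric] by (simp add: algebra_simps)
    also have "\<dots> \<le> exp (\<beta> * dur w - (\<beta> - \<omega>) * h + ((d + 2) * c + c0 + ln (bochi_const TYPE('a))))"
    proof -
      have "(\<beta> - \<omega>) * h \<le> (\<beta> - \<omega>) * fst p"
        using p(2) \<open>\<omega> \<le> \<beta>\<close> by (intro mult_left_mono) auto
      moreover have "0 \<le> d * c"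
        using c d by simp
      ultimately have "\<beta> * dur w - (\<beta> - \<omega>) * fst p + (2 * c + c0) \<le>
          \<beta> * dur w - (\<beta> - \<omega>) * h + ((d + 2) * c + c0 + ln (bochi_const TYPE('a)))"
        using b(1) unfolding distrib_right by linarith
      then show ?thesis by simp
    qed
    finally show ?thesis .
  qed
  then show "norm (wprod w) \<le> exp ((\<beta> - (\<beta> - \<omega>) / (2 * d)) * dur w + ((d + 2) * c + c0 + ln (bochi_const TYPE('a))))"
    unfolding target .
qed

text \<open>Each application of \<open>growth_bounded_improve\<close> multiplies the distance between the proved rate and \<open>\<omega>\<close> by
  \<open>1 - 1 / (2 * DIM('a))\<close>. The number of applications is controlled by the initial distance \<open>D\<close>
  and by \<open>\<epsilon>\<close>, and with it the final constant, which serves all alphabets \<open>P\<close> at once.\<close>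

theorem growth_bounded_uniform:
  fixes \<epsilon> D c0 :: real
  assumes "0 < \<epsilon>" "0 \<le> c0"
  shows "\<exists>c. \<forall>(P :: 'a::euclidean_space timed set) \<beta> \<omega> C.
    (\<forall>p\<in>P. 0 \<le> fst p \<and> norm (snd p) \<le> exp (\<omega> * fst p + c0)) \<longrightarrow>
    growth_bounded P \<beta> 0 \<longrightarrow> growth_bounded P \<omega> C \<longrightarrow> \<beta> - \<omega> \<le> D \<longrightarrow>
    growth_bounded P (\<omega> + \<epsilon>) c"
proof -
  define d where "d = real DIM('a)"
  define \<theta> where "\<theta> = 1 - 1 / (2 * d)"
  have d: "d \<ge> 1"
    using DIM_positive[where 'a='a] by (simp add: d_def Suc_le_eq)
  have \<theta>: "0 \<le> \<theta>" "\<theta> < 1" using d by (auto simp: \<theta>_def)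
  have iter: "\<exists>c. \<forall>(P :: 'a timed set) \<beta> \<omega> C.
    (\<forall>p\<in>P. 0 \<le> fst p \<and> norm (snd p) \<le> exp (\<omega> * fst p + c0)) \<longrightarrow>
    growth_bounded P \<beta> 0 \<longrightarrow> growth_bounded P \<omega> C \<longrightarrow> \<omega> \<le> \<beta> \<longrightarrow>
    growth_bounded P (\<omega> + \<theta> ^ n * (\<beta> - \<omega>)) c" for n
  proof (induction n)
    case 0
    show ?case by (rule exI[of _ 0]) auto
  next
    case (Suc n)
    then obtain c where c: "growth_bounded P (\<omega> + \<theta> ^ n * (\<beta> - \<omega>)) c"
      if "\<forall>p\<in>P. 0 \<le> fst p \<and> norm (snd p) \<le> exp (\<omega> * fst p + c0)"
        "growth_bounded P \<beta> 0" "growth_bounded P \<omega> C" "\<omega> \<le> \<beta>" for P :: "'a timed set" and \<beta> \<omega> C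
      by blast
    show ?case
    proof (intro exI[of _ "(d + 2) * c + c0 + ln (bochi_const TYPE('a))"] allI impI)
      fix P :: "'a timed set" and \<beta> \<omega> C
      assume *: "\<forall>p\<in>P. 0 \<le> fst p \<and> norm (snd p) \<le> exp (\<omega> * fst p + c0)"
        "growth_bounded P \<beta> 0" "growth_bounded P \<omega> C" "\<omega> \<le> \<beta>"
      have "growth_bounded P (\<omega> + \<theta> ^ n * (\<beta> - \<omega>) - (\<omega> + \<theta> ^ n * (\<beta> - \<omega>) - \<omega>) / (2 * d))
          ((d + 2) * c + c0 + ln (bochi_const TYPE('a)))"
        unfolding d_def using c[OF *] * \<theta> assms(2)
        by (intro growth_bounded_improve[where C = C]) auto
      moreover have "\<omega> + \<theta> ^ n * (\<beta> - \<omega>) - (\<omega> + \<theta> ^ n * (\<beta> - \<omega>) - \<omega>) / (2 * d) =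
          \<omega> + \<theta> ^ Suc n * (\<beta> - \<omega>)"
        by (simp add: \<theta>_def algebra_simps)
      ultimately show "growth_bounded P (\<omega> + \<theta> ^ Suc n * (\<beta> - \<omega>))
          ((d + 2) * c + c0 + ln (bochi_const TYPE('a)))"
        by (simp only:)
    qed
  qed
  obtain n where n: "\<theta> ^ n < \<epsilon> / (\<bar>D\<bar> + 1)"
    using real_arch_pow_inv[of "\<epsilon> / (\<bar>D\<bar> + 1)" \<theta>] \<theta> assms(1) by auto
  from iter[of n] obtain c where c: "growth_bounded P (\<omega> + \<theta> ^ n * (\<beta> - \<omega>)) c"
    if "\<forall>p\<in>P. 0 \<le> fst p \<and> norm (snd p) \<le> exp (\<omega> * fst p + c0)"
      "growth_bounded P \<beta> 0" "growth_bounded P \<omega> C" "\<omega> \<le> \<beta>" for P :: "'a timed set" and \<beta> \<omega> C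
    by blast
  show ?thesis
  proof (intro exI[of _ "max 0 c"] allI impI)
    fix P :: "'a timed set" and \<beta> \<omega> C
    assume *: "\<forall>p\<in>P. 0 \<le> fst p \<and> norm (snd p) \<le> exp (\<omega> * fst p + c0)"
      "growth_bounded P \<beta> 0" "growth_bounded P \<omega> C" "\<beta> - \<omega> \<le> D"
    show "growth_bounded P (\<omega> + \<epsilon>) (max 0 c)"
    proof (cases "\<omega> \<le> \<beta>")
      case True
      have "\<theta> ^ n * (\<beta> - \<omega>) \<le> \<epsilon> / (\<bar>D\<bar> + 1) * (\<bar>D\<bar> + 1)"
        using n True *(4) \<theta> assms(1) by (intro mult_mono) auto
      then have "\<omega> + \<theta> ^ n * (\<beta> - \<omega>) \<le> \<omega> + \<epsilon>"
        by simp
      with c[OF *(1-3) True] show ?thesis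
        by (rule growth_bounded_mono) (use * in auto)
    next
      case False
      show ?thesis
        by (rule growth_bounded_mono[OF *(2)]) (use False assms * in auto)
    qed
  qed
qed

section \<open>Flows of dwell-time signals\<close>

definition drift :: "('n::finite) mode \<Rightarrow> real \<Rightarrow> (real^'n) endo" where
  "drift z s = exp (s *\<^sub>R endo_of (fst z))"

text \<open>Only complete phases, closed by their jump, can be concatenated freely: two signals cannot be
  glued in the middle of a phase. The semigroup of the system is therefore built from these letters.\<close>

definition letter :: "('n::finite) mode \<Rightarrow> real \<Rightarrow> (real^'n) timed" where
  "letter z s = (s, endo_of (snd z) * drift z s)"

definition letters :: "('n::finite) mode set \<Rightarrow> real \<Rightarrow> (real^'n) timed set" where
  "letters S \<tau> = {letter z s | z s. z \<in> S \<and> \<tau> \<le> s}"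

lemma drift_0 [simp]: "drift z 0 = 1"
  by (simp add: drift_def)

lemma drift_add: "drift z (s + t) = drift z s * drift z t"
  unfolding drift_def scaleR_add_left by (rule exp_add_commuting) simp

lemma linear_ode_unique:
  fixes x :: "real \<Rightarrow> 'a::euclidean_space"
  assumes "convex T" "t0 \<in> T" "t \<in> T"
    and x: "\<And>t. t \<in> T \<Longrightarrow> (x has_vector_derivative app B (x t)) (at t within T)"
  shows "x t = app (exp ((t - t0) *\<^sub>R B)) (x t0)"
proof -
  \<comment> \<open>Pulling the solution back along the flow makes it constant.\<close>
  have "((\<lambda>t. app (exp (t *\<^sub>R - B)) (x t)) has_vector_derivative 0) (at t within T)" if "t \<in> T" for t
  proof -
    have "((\<lambda>t. app (exp (t *\<^sub>R - B)) (x t)) has_vector_derivative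
        app (exp (t *\<^sub>R - B)) (app B (x t)) + app (exp (t *\<^sub>R - B) * - B) (x t)) (at t within T)"
      by (rule app.has_vector_derivative[OF exp_scaleR_has_vector_derivative_right x[OF that]])
    then show ?thesis
      by (simp add: app_mult app.minus_left app.minus_right)
  qed
  then obtain c where c: "\<And>t. t \<in> T \<Longrightarrow> app (exp (t *\<^sub>R - B)) (x t) = c"
    using has_vector_derivative_zero_constant[OF assms(1)] by blast
  have add: "exp (r *\<^sub>R B) * exp (s *\<^sub>R - B) = exp ((r - s) *\<^sub>R B)" for r s
    by (subst exp_add_commuting[symmetric]) (simp_all add: scaleR_diff_left)
  have "x t = app (exp (t *\<^sub>R B) * exp (t *\<^sub>R - B)) (x t)"
    unfolding add by simp
  also have "\<dots> = app (exp (t *\<^sub>R B) * exp (t0 *\<^sub>R - B)) (x t0)"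
    unfolding app_mult using c assms(2,3) by simp
  finally show ?thesis
    unfolding add .
qed

lemma drift_has_vector_derivative:
  "((\<lambda>t. app (drift z (t - a)) v) has_vector_derivative fst z *v app (drift z (t - a)) v) (at t within T)"
proof -
  let ?B = "endo_of (fst z)"
  have "((\<lambda>t. exp (t *\<^sub>R ?B)) has_vector_derivative ?B * exp ((t - a) *\<^sub>R ?B)) (at (t - a))"
    by (rule exp_scaleR_has_vector_derivative_left)
  moreover have "((\<lambda>t. t - a) has_vector_derivative 1) (at t within T)"
    by (auto intro!: derivative_eq_intros)
  ultimately have "((\<lambda>t. drift z (t - a)) has_vector_derivative ?B * drift z (t - a)) (at t within T)"
    unfolding drift_def
    using vector_diff_chain_within[of "\<lambda>t. t - a" 1 t T "\<lambda>t. exp (t *\<^sub>R ?B)"]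
    by (simp add: o_def has_vector_derivative_at_within)
  from app.has_vector_derivative[OF this has_vector_derivative_const[of v]] show ?thesis
    by (simp add: app_mult app.zero_right)
qed

primrec jump_prod :: "('n::finite) mode signal \<Rightarrow> nat \<Rightarrow> (real^'n) endo" where
  "jump_prod Z 0 = 1"
| "jump_prod Z (Suc k) = snd (letter (val Z (tm Z k)) (tm Z (Suc k) - tm Z k)) * jump_prod Z k"

lemma steps_Suc: "Suc k \<in> steps Z \<Longrightarrow> k \<in> steps0 Z"
  by (cases k; cases "num Z") (auto simp: steps_def steps0_def)

lemma steps_subset: "k \<in> steps Z \<Longrightarrow> k \<in> steps0 Z"
  by (simp add: steps0_def)

lemma phase_Suc: "Suc k \<in> steps Z \<Longrightarrow> phase Z k = {tm Z k..<tm Z (Suc k)}"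
  by (auto simp: phase_def next_tm_def)

lemma phase_last: "Suc k \<notin> steps Z \<Longrightarrow> phase Z k = {tm Z k..}"
  by (auto simp: phase_def next_tm_def)

lemma convex_phase: "convex (phase Z k)"
  by (cases "Suc k \<in> steps Z") (auto simp: phase_Suc phase_last)

context
  fixes Z :: "('n::finite) mode signal" and S and \<tau> :: real
  assumes Z: "Z \<in> dwell_signals S \<tau>" and \<tau>: "0 < \<tau>"
begin

lemma tm_0: "tm Z 0 = 0"
  using Z by (simp add: dwell_signals_def signals_def)

lemma tm_gap: "Suc k \<in> steps Z \<Longrightarrow> tm Z k + \<tau> \<le> tm Z (Suc k)"
proof -
  assume k: "Suc k \<in> steps Z"
  then have "ereal (tm Z k + \<tau>) \<le> next_tm Z k"
    using Z steps_Suc[OF k] by (simp add: dwell_signals_def)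
  with k show ?thesis by (simp add: next_tm_def)
qed

lemma tm_in_phase: "tm Z k \<in> phase Z k"
  using tm_gap[of k] \<tau> by (cases "Suc k \<in> steps Z") (auto simp: phase_Suc phase_last)

lemma tm_ge: "k \<in> steps0 Z \<Longrightarrow> real k * \<tau> \<le> tm Z k"
proof (induction k)
  case 0
  then show ?case by (simp add: tm_0)
next
  case (Suc k)
  then have "Suc k \<in> steps Z" by (simp add: steps0_def)
  with Suc.IH steps_Suc tm_gap[of k] show ?case by (fastforce simp: algebra_simps)
qed

lemma tm_nonneg: "k \<in> steps0 Z \<Longrightarrow> 0 \<le> tm Z k"
  using tm_ge[of k] \<tau> by (meson less_imp_le mult_nonneg_nonneg of_nat_0_le_iff order_trans)

lemma val_mem: "k \<in> steps0 Z \<Longrightarrow> val Z (tm Z k) \<in> S"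
  using Z tm_nonneg by (simp add: dwell_signals_def signals_def)

lemma tm_Suc_le: "j < k \<Longrightarrow> k \<in> steps0 Z \<Longrightarrow> tm Z (Suc j) \<le> tm Z k"
proof (induction k)
  case (Suc k)
  then have k: "Suc k \<in> steps Z" by (simp add: steps0_def)
  show ?case
  proof (cases "j = k")
    case False
    with Suc steps_Suc[OF k] have "tm Z (Suc j) \<le> tm Z k" by simp
    with tm_gap[OF k] \<tau> show ?thesis by simp
  qed simp
qed simp

lemma phase_unique:
  assumes "j \<in> steps0 Z" "k \<in> steps0 Z" "t \<in> phase Z j" "t \<in> phase Z k"
  shows "j = k"
proof -
  have less: False if "j < k" "k \<in> steps0 Z" "t \<in> phase Z j" "t \<in> phase Z k" for j k
  proof -
    have "Suc j \<in> steps Z"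
      using that(1,2) by (cases "num Z") (auto simp: steps_def steps0_def)
    with that tm_Suc_le[of j k] show False
      by (auto simp: phase_Suc) (auto simp: phase_def)
  qed
  show ?thesis
    using less[of j k] less[of k j] assms by (meson linorder_neqE_nat)
qed

lemma phase_exists:
  assumes "0 \<le> t"
  shows "\<exists>k\<in>steps0 Z. t \<in> phase Z k"
proof -
  let ?K = "{k \<in> steps0 Z. tm Z k \<le> t}"
  have "k \<le> nat \<lceil>t / \<tau>\<rceil>" if "k \<in> ?K" for k
  proof -
    have "real k \<le> t / \<tau>"
      using that tm_ge[of k] \<tau> by (simp add: field_simps)
    then show ?thesis by linarith
  qed
  then have fin: "finite ?K"
    by (meson finite_nat_set_iff_bounded_le)
  have ne: "0 \<in> ?K"
    using assms by (simp add: steps0_def tm_0)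
  define k where "k = Max ?K"
  have k: "k \<in> steps0 Z" "tm Z k \<le> t"
    using Max_in[OF fin] ne by (auto simp: k_def)
  moreover have "t < tm Z (Suc k)" if "Suc k \<in> steps Z"
  proof (rule ccontr)
    assume "\<not> t < tm Z (Suc k)"
    then have "Suc k \<in> ?K" using that by (simp add: steps0_def)
    then have "Suc k \<le> k" unfolding k_def by (rule Max_ge[OF fin])
    then show False by simp
  qed
  ultimately show ?thesis
    by (intro bexI[of _ k]) (auto simp: phase_def next_tm_def)
qed

lemma solution_on_phase:
  assumes x: "is_solution Z x" and k: "k \<in> steps0 Z" and t: "t \<in> phase Z k"
  shows "x t = app (drift (val Z (tm Z k)) (t - tm Z k)) (x (tm Z k))"
  unfolding drift_def
  by (rule linear_ode_unique[OF convex_phase tm_in_phase t])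
    (use x k in \<open>simp add: is_solution_def\<close>)

lemma drift_tendsto: "((\<lambda>t. app (drift z (t - a)) v) \<longlongrightarrow> app (drift z (b - a)) v) (at b within T)"
  using has_vector_derivative_continuous[OF drift_has_vector_derivative[of z a v b T]]
  by (simp add: continuous_within)

lemma eventually_at_left_phase:
  assumes "Suc k \<in> steps Z"
  shows "eventually (\<lambda>t. t \<in> phase Z k) (at_left (tm Z (Suc k)))"
proof -
  have "tm Z k < tm Z (Suc k)"
    using tm_gap[OF assms] \<tau> by simp
  then show ?thesis
    unfolding phase_Suc[OF assms] by (auto simp: eventually_at_left intro!: exI[of _ "tm Z k"])
qed

lemma solution_at_switch:
  assumes x: "is_solution Z x" and k: "k \<in> steps0 Z"
  shows "x (tm Z k) = app (jump_prod Z k) (x 0)"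
  using k
proof (induction k)
  case 0
  show ?case by (simp add: tm_0)
next
  case (Suc k)
  then have k: "Suc k \<in> steps Z" by (simp add: steps0_def)
  let ?z = "val Z (tm Z k)" and ?t = "tm Z (Suc k)"
  from x k obtain l where l: "(x \<longlongrightarrow> l) (at_left ?t)" "x ?t = snd ?z *v l"
    by (force simp: is_solution_def)
  have "((\<lambda>t. app (drift ?z (t - tm Z k)) (x (tm Z k))) \<longlongrightarrow> l) (at_left ?t)"
  proof (rule Lim_transform_eventually[OF l(1)])
    show "\<forall>\<^sub>F t in at_left ?t. x t = app (drift ?z (t - tm Z k)) (x (tm Z k))"
      using eventually_at_left_phase[OF k]
      by eventually_elim (rule solution_on_phase[OF x steps_Suc[OF k]])
  qed
  then have "l = app (drift ?z (?t - tm Z k)) (x (tm Z k))"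
    using drift_tendsto by (rule tendsto_unique[rotated]) simp
  with l(2) Suc.IH steps_Suc[OF k] show ?case
    by (simp add: letter_def app_mult)
qed

lemma solution_exists: "\<exists>x. is_solution Z x \<and> x 0 = x0"
proof -
  define idx where "idx t = (THE k. k \<in> steps0 Z \<and> t \<in> phase Z k)" for t
  have idx: "idx t = k" if "k \<in> steps0 Z" "t \<in> phase Z k" for t k
    unfolding idx_def using that phase_unique by blast
  define x where "x t = app (drift (val Z (tm Z (idx t))) (t - tm Z (idx t)) * jump_prod Z (idx t)) x0" for t
  have x: "x t = app (drift (val Z (tm Z k)) (t - tm Z k)) (app (jump_prod Z k) x0)"
    if "k \<in> steps0 Z" "t \<in> phase Z k" for t k
    using idx[OF that] by (simp add: x_def app_mult)
  have x_tm: "x (tm Z k) = app (jump_prod Z k) x0" if "k \<in> steps0 Z" for k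
    using x[OF that tm_in_phase] by simp
  have "is_solution Z x"
    unfolding is_solution_def
  proof (intro conjI ballI)
    fix k t assume k: "k \<in> steps0 Z" and t: "t \<in> phase Z k"
    show "(x has_vector_derivative fst (val Z (tm Z k)) *v x t) (at t within phase Z k)"
      unfolding x[OF k t]
      by (rule has_vector_derivative_transform[OF t _ drift_has_vector_derivative]) (simp add: x[OF k])
  next
    fix k assume k: "k \<in> steps Z"
    then obtain j where j: "k = Suc j" by (cases k) (auto simp: steps_def)
    then have js: "Suc j \<in> steps Z" using k by simp
    let ?l = "app (drift (val Z (tm Z j)) (tm Z k - tm Z j)) (app (jump_prod Z j) x0)"
    have "(x \<longlongrightarrow> ?l) (at_left (tm Z k))"
    proof (rule Lim_transform_eventually[OF drift_tendsto])
      show "\<forall>\<^sub>F t in at_left (tm Z k).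
          app (drift (val Z (tm Z j)) (t - tm Z j)) (app (jump_prod Z j) x0) = x t"
        unfolding j using eventually_at_left_phase[OF js]
        by eventually_elim (rule x[OF steps_Suc[OF js], symmetric])
    qed
    moreover have "x (tm Z k) = snd (val Z (tm Z (k - 1))) *v ?l"
      using x_tm[OF steps_subset[OF k]] by (simp add: j letter_def app_mult)
    ultimately show "\<exists>l. (x \<longlongrightarrow> l) (at_left (tm Z k)) \<and> x (tm Z k) = snd (val Z (tm Z (k - 1))) *v l"
      by blast
  qed
  moreover have "x 0 = x0"
    using x_tm[of 0] by (simp add: tm_0 steps0_def)
  ultimately show ?thesis by blast
qed

text \<open>The definite description in \<^const>\<open>flow_matrix\<close> is resolved: solutions with a given initial value are
  determined phase by phase, and one exists for every initial value.\<close>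

theorem endo_of_flow_matrix:
  assumes k: "k \<in> steps0 Z" and t: "t \<in> phase Z k"
  shows "endo_of (flow_matrix Z t) = drift (val Z (tm Z k)) (t - tm Z k) * jump_prod Z k"
proof -
  let ?E = "drift (val Z (tm Z k)) (t - tm Z k) * jump_prod Z k"
  obtain M where M: "endo_of M = ?E" using surj_endo_of by blast
  have sol: "x t = M *v x 0" if "is_solution Z x" for x
  proof -
    have "x t = app (endo_of M) (x 0)"
      unfolding M app_mult using solution_on_phase[OF that k t] solution_at_switch[OF that k] by simp
    then show ?thesis by simp
  qed
  have "flow_matrix Z t = M"
    unfolding flow_matrix_def
  proof (rule the_equality)
    show "\<forall>x. is_solution Z x \<longrightarrow> x t = M *v x 0"
      using sol by blast
    fix M' assume M': "\<forall>x. is_solution Z x \<longrightarrow> x t = M' *v x 0"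
    have "M' *v v = M *v v" for v
      using solution_exists[of v] M' sol by metis
    then show "M' = M"
      by (simp add: matrix_eq)
  qed
  with M show ?thesis by simp
qed

lemma jump_prod_word:
  "k \<in> steps0 Z \<Longrightarrow> \<exists>w\<in>lists (letters S \<tau>). dur w = tm Z k \<and> wprod w = jump_prod Z k"
proof (induction k)
  case 0
  show ?case by (rule bexI[of _ "[]"]) (auto simp: tm_0)
next
  case (Suc k)
  then have k: "Suc k \<in> steps Z" by (simp add: steps0_def)
  with Suc.IH steps_Suc obtain w where w: "w \<in> lists (letters S \<tau>)" "dur w = tm Z k" "wprod w = jump_prod Z k"
    by blast
  let ?p = "letter (val Z (tm Z k)) (tm Z (Suc k) - tm Z k)"
  have "?p \<in> letters S \<tau>"
    unfolding letters_def using val_mem[OF steps_Suc[OF k]] tm_gap[OF k]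
    by (intro CollectI exI conjI refl) auto
  with w show ?case
    by (intro bexI[of _ "?p # w"]) (auto simp: letter_def)
qed

text \<open>The phase that contains \<open>t\<close> may be cut off before the dwell time has elapsed; it contributes the
  factor \<open>drift z \<sigma>\<close>, which is not a letter.\<close>

lemma flow_matrix_word:
  assumes "0 \<le> t"
  obtains w z \<sigma> where "w \<in> lists (letters S \<tau>)" "z \<in> S" "0 \<le> \<sigma>" "t = dur w + \<sigma>"
    "endo_of (flow_matrix Z t) = drift z \<sigma> * wprod w"
proof -
  obtain k where k: "k \<in> steps0 Z" "t \<in> phase Z k"
    using phase_exists[OF assms] by blast
  obtain w where "w \<in> lists (letters S \<tau>)" "dur w = tm Z k" "wprod w = jump_prod Z k"
    using jump_prod_word[OF k(1)] by blast
  moreover have "tm Z k \<le> t" using k(2) by (simp add: phase_def)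
  ultimately show thesis
    using that[of w "val Z (tm Z k)" "t - tm Z k"] val_mem[OF k(1)] endo_of_flow_matrix[OF k] by simp
qed

end

lemma dwell_signalsI:
  assumes "num Z = enat n" "\<And>t. 0 \<le> t \<Longrightarrow> val Z t \<in> S" "tm Z 0 = 0" "0 < \<tau>"
    and gap: "\<And>k. k < n \<Longrightarrow> tm Z k + \<tau> \<le> tm Z (Suc k)"
    and const: "\<And>k t. k < n \<Longrightarrow> tm Z k \<le> t \<Longrightarrow> t < tm Z (Suc k) \<Longrightarrow> val Z t = val Z (tm Z k)"
    and last: "\<And>t. tm Z n \<le> t \<Longrightarrow> val Z t = val Z (tm Z n)"
  shows "Z \<in> dwell_signals S \<tau>"
proof -
  have steps: "steps Z = {1..n}" and steps0: "steps0 Z = {0..n}"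
    using assms(1) by (auto simp: steps_def steps0_def)
  have le: "tm Z j + \<tau> * real (k - j) \<le> tm Z k" if "j \<le> k" "k \<le> n" for j k
    using that
  proof (induction k)
    case (Suc k)
    show ?case
    proof (cases "j = Suc k")
      case False
      with Suc gap[of k] show ?thesis by (simp add: Suc_diff_le algebra_simps)
    qed simp
  qed simp
  have less: "tm Z j < tm Z k" if "j < k" "k \<le> n" for j k
  proof -
    have "0 < \<tau> * real (k - j)" using assms(4) that by simp
    with le[of j k] that show ?thesis by linarith
  qed
  have "\<not> x islimpt (tm Z ` steps Z)" for x
    unfolding steps by (intro islimpt_finite) simp
  moreover have "strict_mono_on (steps Z) (tm Z)"
    unfolding steps by (intro strict_mono_onI less) auto
  moreover have "0 < tm Z k" if "k \<in> steps Z" for k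
    using less[of 0 k] that assms(3) by (auto simp: steps)
  moreover have "val Z t = val Z (tm Z k)" if "k \<in> steps0 Z" "t \<in> phase Z k" for k t
  proof (cases "k < n")
    case True
    with that(2) show ?thesis by (intro const) (auto simp: phase_def next_tm_def steps)
  next
    case False
    then have "k = n" using that(1) by (simp add: steps0)
    with that(2) last[of t] show ?thesis by (simp add: phase_def)
  qed
  moreover have "ereal (tm Z k + \<tau>) \<le> next_tm Z k" if "k \<in> steps0 Z" for k
    using gap[of k] by (auto simp: next_tm_def steps)
  ultimately show ?thesis
    using assms(2,3) by (simp add: dwell_signals_def signals_def)
qed

text \<open>Induction on the earliest letter, which is the last of the list: the signal of the other letters is
  shifted in time and one phase is put in front of it.\<close>

lemma word_realizable:
  assumes "w \<in> lists (letters S \<tau>)" "z \<in> S" "0 < \<tau>"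
  shows "\<exists>Z n. Z \<in> dwell_signals S \<tau> \<and> num Z = enat n \<and> tm Z n = dur w \<and>
    val Z (tm Z n) = z \<and> jump_prod Z n = wprod w"
  using assms(1)
proof (induction w rule: rev_induct)
  case Nil
  let ?Z = "\<lparr>val = \<lambda>_. z, num = enat 0, tm = \<lambda>_. 0\<rparr>"
  have "?Z \<in> dwell_signals S \<tau>"
    by (rule dwell_signalsI[where n = 0]) (use assms in auto)
  then show ?case by (intro exI[of _ ?Z] exI[of _ 0]) auto
next
  case (snoc p w)
  then obtain Z n where Z: "Z \<in> dwell_signals S \<tau>" "num Z = enat n" "tm Z n = dur w"
    "val Z (tm Z n) = z" "jump_prod Z n = wprod w"
    by auto
  from snoc.prems obtain y s where p: "p = letter y s" "y \<in> S" "\<tau> \<le> s"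
    by (auto simp: letters_def)
  let ?Z = "\<lparr>val = \<lambda>t. if t < s then y else val Z (t - s), num = enat (Suc n),
    tm = \<lambda>k. case k of 0 \<Rightarrow> 0 | Suc j \<Rightarrow> s + tm Z j\<rparr>"
  have k0: "k \<in> steps0 Z" if "k \<le> n" for k
    using that Z(2) by (auto simp: steps_def steps0_def)
  have kS: "Suc k \<in> steps Z" if "k < n" for k
    using that Z(2) by (auto simp: steps_def)
  have tm: "0 \<le> tm Z k" if "k \<le> n" for k
    using tm_nonneg[OF Z(1) assms(3) k0[OF that]] .
  have const: "val Z t = val Z (tm Z k)" if "k \<le> n" "t \<in> phase Z k" for k t
    using Z(1) k0[OF that(1)] that(2) by (simp add: dwell_signals_def signals_def)
  have "?Z \<in> dwell_signals S \<tau>"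
  proof (rule dwell_signalsI[where n = "Suc n"])
    show "val ?Z t \<in> S" if "0 \<le> t" for t
      using p Z(1) by (simp add: dwell_signals_def signals_def)
    show "tm ?Z k + \<tau> \<le> tm ?Z (Suc k)" if "k < Suc n" for k
      using that p tm_0[OF Z(1) assms(3)] tm_gap[OF Z(1) assms(3) kS] by (cases k) auto
    show "val ?Z t = val ?Z (tm ?Z k)" if "k < Suc n" "tm ?Z k \<le> t" "t < tm ?Z (Suc k)" for k t
    proof (cases k)
      case 0
      then show ?thesis using that p assms(3) tm_0[OF Z(1) assms(3)] by auto
    next
      case (Suc j)
      then have "t - s \<in> phase Z j"
        using that kS[of j] by (auto simp: phase_Suc)
      from const[OF _ this] Suc that tm[of j] show ?thesis by auto
    qed
    show "val ?Z t = val ?Z (tm ?Z (Suc n))" if "tm ?Z (Suc n) \<le> t" for t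
    proof -
      have "Suc n \<notin> steps Z" using Z(2) by (simp add: steps_def)
      then have "t - s \<in> phase Z n" using that by (auto simp: phase_last)
      from const[OF _ this] that tm[of n] show ?thesis by auto
    qed
  qed (use assms in auto)
  moreover have "jump_prod ?Z (Suc k) = jump_prod Z k * snd p" if "k \<le> n" for k
    using that
  proof (induction k)
    case 0
    show ?case using p assms(3) tm_0[OF Z(1) assms(3)] by simp
  next
    case (Suc k)
    then have "jump_prod ?Z (Suc (Suc k)) =
        snd (letter (val ?Z (tm ?Z (Suc k))) (tm ?Z (Suc (Suc k)) - tm ?Z (Suc k))) * (jump_prod Z k * snd p)"
      by simp
    also have "val ?Z (tm ?Z (Suc k)) = val Z (tm Z k)"
      using tm[of k] Suc.prems by simp
    finally show ?case by (simp add: mult.assoc)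
  qed
  from this[of n] have "jump_prod ?Z (Suc n) = wprod (w @ [p])"
    by (simp add: Z(5))
  moreover have "tm ?Z (Suc n) = dur (w @ [p])"
    by (simp add: Z(3) p letter_def)
  moreover have "val ?Z (tm ?Z (Suc n)) = z"
    using Z(4) tm[of n] by simp
  ultimately show ?case
    by (intro exI[of _ ?Z] exI[of _ "Suc n"]) auto
qed

lemma word_flow_matrix:
  assumes "w \<in> lists (letters S \<tau>)" "z \<in> S" "0 < \<tau>" "0 \<le> \<sigma>"
  obtains Z where "Z \<in> dwell_signals S \<tau>"
    "endo_of (flow_matrix Z (dur w + \<sigma>)) = drift z \<sigma> * wprod w"
proof -
  obtain Z n where Z: "Z \<in> dwell_signals S \<tau>" "num Z = enat n" "tm Z n = dur w"
    "val Z (tm Z n) = z" "jump_prod Z n = wprod w"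
    using word_realizable[OF assms(1-3)] by blast
  have "n \<in> steps0 Z" "Suc n \<notin> steps Z"
    using Z(2) by (auto simp: steps_def steps0_def)
  with endo_of_flow_matrix[OF Z(1) assms(3), of n "dur w + \<sigma>"] Z assms(4) show thesis
    by (intro that[OF Z(1)]) (simp add: phase_last)
qed

section \<open>The Lyapunov exponent and growth of words\<close>

lemma norm_exp_diff_le:
  fixes X Y :: "'a::{real_normed_algebra_1,banach}"
  assumes "norm X \<le> M" "norm Y \<le> M"
  shows "norm (exp X - exp Y) \<le> exp M * norm (X - Y)"
proof -
  \<comment> \<open>Duhamel's interpolation between \<open>exp Y\<close> and \<open>exp X\<close>, which need not commute.\<close>
  let ?g = "\<lambda>s. exp (s *\<^sub>R X) * exp ((1 - s) *\<^sub>R Y)"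
  let ?g' = "\<lambda>s. exp (s *\<^sub>R X) * (X - Y) * exp ((1 - s) *\<^sub>R Y)"
  have deriv: "(?g has_vector_derivative ?g' s) (at s within {0..1})" for s
  proof -
    have "((\<lambda>s. exp (s *\<^sub>R Y)) has_vector_derivative Y * exp ((1 - s) *\<^sub>R Y)) (at (1 - s) within (\<lambda>s. 1 - s) ` {0..1})"
      by (rule has_vector_derivative_at_within[OF exp_scaleR_has_vector_derivative_left])
    moreover have "((\<lambda>s. 1 - s) has_vector_derivative - 1) (at s within {0..1::real})"
      by (auto intro!: derivative_eq_intros)
    ultimately have "((\<lambda>s. exp ((1 - s) *\<^sub>R Y)) has_vector_derivative - (Y * exp ((1 - s) *\<^sub>R Y))) (at s within {0..1})"
      using vector_diff_chain_within[of "\<lambda>s. 1 - s" "-1" s "{0..1}" "\<lambda>s. exp (s *\<^sub>R Y)"]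
      by (simp add: o_def)
    from has_vector_derivative_mult[OF exp_scaleR_has_vector_derivative_right this, of X]
    show ?thesis
      by (simp add: algebra_simps)
  qed
  have "norm (?g' s) \<le> exp M * norm (X - Y)" if "s \<in> {0..1}" for s
  proof -
    have X: "norm (exp (s *\<^sub>R X)) \<le> exp (s * M)"
      using that assms(1) by (intro order_trans[OF norm_exp]) (auto intro: mult_left_mono)
    have Y: "norm (exp ((1 - s) *\<^sub>R Y)) \<le> exp ((1 - s) * M)"
      using that assms(2) by (intro order_trans[OF norm_exp]) (auto intro: mult_left_mono)
    have "norm (?g' s) \<le> norm (exp (s *\<^sub>R X)) * norm (X - Y) * norm (exp ((1 - s) *\<^sub>R Y))"
      by (meson norm_mult_ineq mult_right_mono norm_ge_zero order_trans)
    also have "\<dots> \<le> exp (s * M) * norm (X - Y) * exp ((1 - s) * M)"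
      using X Y by (intro mult_mono) auto
    also have "\<dots> = exp (s * M + (1 - s) * M) * norm (X - Y)"
      by (simp only: exp_add mult_ac)
    finally show ?thesis by (simp add: algebra_simps)
  qed
  then have on: "onorm (\<lambda>h. h *\<^sub>R ?g' s) \<le> exp M * norm (X - Y)" if "s \<in> {0..1}" for s
    using that by (intro onorm_le) (simp add: mult.commute mult_left_mono)
  have "norm (?g 1 - ?g 0) \<le> exp M * norm (X - Y) * norm (1 - 0 :: real)"
    by (rule differentiable_bound[OF _ deriv[unfolded has_vector_derivative_def] on]) auto
  then show ?thesis by simp
qed

definition modes_within :: "real \<Rightarrow> ('n::finite) mode set \<Rightarrow> bool" where
  "modes_within K S \<longleftrightarrow> S \<noteq> {} \<and>
     (\<forall>z\<in>S. norm (endo_of (fst z)) \<le> K \<and> norm (endo_of (snd z)) \<le> K)"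

lemma norm_drift_le:
  assumes "norm (endo_of (fst z)) \<le> K" "0 \<le> s"
  shows "norm (drift z s) \<le> exp (K * s)"
  unfolding drift_def using assms
  by (intro order_trans[OF norm_exp]) (simp add: mult.commute[of K] mult_left_mono)

lemma norm_drift_ge:
  assumes "norm (endo_of (fst z)) \<le> K" "0 \<le> s"
  shows "exp (- K * s) \<le> norm (drift z s)"
proof -
  have "norm (drift z (- s)) \<le> exp (K * s)"
    unfolding drift_def using assms
    by (intro order_trans[OF norm_exp]) (simp add: mult.commute[of K] mult_left_mono)
  moreover have "1 \<le> norm (drift z (- s)) * norm (drift z s)"
    using drift_add[of z "- s" s] norm_mult_ineq[of "drift z (- s)" "drift z s"] by simp
  ultimately have "1 \<le> exp (K * s) * norm (drift z s)"
    by (meson mult_right_mono norm_ge_zero order_trans)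
  then show ?thesis
    by (simp add: exp_minus field_simps)
qed

text \<open>The bound \<open>K\<close> of a jump is absorbed into the rate because successive jumps are at least \<open>\<tau>\<close> apart.\<close>

lemma growth_bounded_letters:
  assumes "modes_within K S" "1 \<le> K" "0 < \<tau>"
  shows "growth_bounded (letters S \<tau>) (K + ln K / \<tau>) 0"
proof (rule growth_bounded_submultiplicative)
  fix p assume "p \<in> letters S \<tau>"
  then obtain z s where p: "p = letter z s" "z \<in> S" "\<tau> \<le> s" by (auto simp: letters_def)
  have z: "norm (endo_of (fst z)) \<le> K" "norm (endo_of (snd z)) \<le> K"
    using assms(1) p(2) by (auto simp: modes_within_def)
  have "norm (snd p) \<le> norm (endo_of (snd z)) * norm (drift z s)"
    by (simp add: p letter_def norm_mult_ineq)
  also have "\<dots> \<le> K * exp (K * s)"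
    using z assms p(3) by (intro mult_mono norm_drift_le) auto
  also have "\<dots> = exp (ln K + K * s)"
    using assms(2) by (simp add: exp_add)
  also have "ln K * 1 \<le> ln K * (s / \<tau>)"
    using assms(2,3) p(3) by (intro mult_left_mono) auto
  then have "exp (ln K + K * s) \<le> exp ((K + ln K / \<tau>) * fst p)"
    by (simp add: p letter_def algebra_simps)
  finally show "norm (snd p) \<le> exp ((K + ln K / \<tau>) * fst p)" .
qed

lemma letters_nonneg: "0 < \<tau> \<Longrightarrow> p \<in> letters S \<tau> \<Longrightarrow> 0 \<le> fst p"
  by (auto simp: letters_def letter_def)

lemma elog_le_iff:
  assumes "0 \<le> r"
  shows "elog r \<le> ereal b \<longleftrightarrow> r \<le> exp b"
proof (cases "r = 0")
  case False
  then show ?thesis using assms ln_le_cancel_iff[of r "exp b"] by (simp add: elog_def)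
qed (simp add: elog_def)

lemma ereal_le_elog: "exp b \<le> r \<Longrightarrow> ereal b \<le> elog r"
  using less_le_trans[OF exp_gt_zero[of b]] ln_ge_iff[of r b] by (auto simp: elog_def)

lemma lyap_exp_le:
  assumes \<tau>: "0 < \<tau>" and w: "growth_bounded (letters S \<tau>) \<omega> c"
    and z: "\<And>z \<sigma>. z \<in> S \<Longrightarrow> 0 \<le> \<sigma> \<Longrightarrow> norm (drift z \<sigma>) \<le> exp (\<omega> * \<sigma> + c')"
  shows "lyap_exp S \<tau> \<le> ereal \<omega>"
proof -
  let ?f = "\<lambda>t. ereal (1 / t) * (SUP Z\<in>dwell_signals S \<tau>. elog (op_norm (flow_matrix Z t)))"
  have "?f t \<le> ereal (\<omega> + (c + c') / t)" if t: "0 < t" for t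
  proof -
    have "(SUP Z\<in>dwell_signals S \<tau>. elog (op_norm (flow_matrix Z t))) \<le> ereal (\<omega> * t + (c + c'))"
    proof (rule SUP_least)
      fix Z assume Z: "Z \<in> dwell_signals S \<tau>"
      obtain w' y \<sigma> where f: "w' \<in> lists (letters S \<tau>)" "y \<in> S" "0 \<le> \<sigma>" "t = dur w' + \<sigma>"
        "endo_of (flow_matrix Z t) = drift y \<sigma> * wprod w'"
        by (rule flow_matrix_word[OF Z \<tau> less_imp_le[OF t]])
      have "op_norm (flow_matrix Z t) \<le> norm (drift y \<sigma>) * norm (wprod w')"
        unfolding norm_endo_of[symmetric] f(5) by (rule norm_mult_ineq)
      also have "\<dots> \<le> exp (\<omega> * \<sigma> + c') * exp (\<omega> * dur w' + c)"
        using z[OF f(2,3)] growth_boundedD[OF w f(1)] by (intro mult_mono) auto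
      also have "\<dots> = exp (\<omega> * t + (c + c'))"
        unfolding exp_add[symmetric] by (simp add: f(4) algebra_simps)
      finally show "elog (op_norm (flow_matrix Z t)) \<le> ereal (\<omega> * t + (c + c'))"
        by (subst elog_le_iff) (auto simp flip: norm_endo_of)
    qed
    then have "?f t \<le> ereal (1 / t) * ereal (\<omega> * t + (c + c'))"
      using that by (intro ereal_mult_left_mono) auto
    also have "\<dots> = ereal (\<omega> + (c + c') / t)"
      using that by (simp add: field_simps)
    finally show ?thesis .
  qed
  then have "Limsup at_top ?f \<le> Limsup at_top (\<lambda>t. ereal (\<omega> + (c + c') / t))"
    by (intro Limsup_mono eventually_mono[OF eventually_gt_at_top[of "0::real"]])
  also have "\<dots> = ereal \<omega>"
  proof (rule lim_imp_Limsup)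
    have "((\<lambda>t. (c + c') / t) \<longlongrightarrow> 0) at_top"
      by (rule tendsto_divide_0[OF tendsto_const filterlim_at_top_imp_at_infinity[OF filterlim_ident]])
    from tendsto_add[OF tendsto_const[of \<omega>] this]
    show "((\<lambda>t. ereal (\<omega> + (c + c') / t)) \<longlongrightarrow> ereal \<omega>) at_top"
      by simp
  qed simp
  finally show ?thesis
    by (simp add: lyap_exp_def)
qed

text \<open>A constant signal has an invertible flow, so the exponent cannot drop below \<open>- K\<close>, even if all
  jumps are \<open>0\<close>. In particular the value \<open>-\<infinity>\<close> does not occur.\<close>

lemma lyap_exp_ge:
  fixes S :: "('n::finite) mode set"
  assumes \<tau>: "0 < \<tau>" and S: "modes_within K S"
  shows "ereal (- K) \<le> lyap_exp S \<tau>"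
  unfolding lyap_exp_def
proof (rule le_Limsup)
  let ?f = "\<lambda>t. ereal (1 / t) * (SUP Z\<in>dwell_signals S \<tau>. elog (op_norm (flow_matrix Z t)))"
  obtain z where z: "z \<in> S" "norm (endo_of (fst z)) \<le> K"
    using S by (auto simp: modes_within_def)
  have "ereal (- K) \<le> ?f t" if t: "0 < t" for t
  proof -
    obtain Z where Z: "Z \<in> dwell_signals S \<tau>" "endo_of (flow_matrix Z (dur ([] :: (real^'n) timed list) + t)) = drift z t * wprod []"
      by (rule word_flow_matrix[OF lists.Nil z(1) \<tau> less_imp_le[OF t]])
    then have "exp (- K * t) \<le> op_norm (flow_matrix Z t)"
      unfolding norm_endo_of[symmetric] using norm_drift_ge[OF z(2), of t] that by simp
    then have "ereal (- K * t) \<le> elog (op_norm (flow_matrix Z t))"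
      by (rule ereal_le_elog)
    also have "\<dots> \<le> (SUP Z\<in>dwell_signals S \<tau>. elog (op_norm (flow_matrix Z t)))"
      by (rule SUP_upper[OF Z(1)])
    finally have "ereal (1 / t) * ereal (- K * t) \<le> ?f t"
      using that by (intro ereal_mult_left_mono) auto
    then show ?thesis using that by simp
  qed
  then show "\<forall>\<^sub>F t in at_top. ereal (- K) \<le> ?f t"
    by (rule eventually_mono[OF eventually_gt_at_top[of "0::real"]])
qed simp

lemma lyap_exp_finite:
  assumes "0 < \<tau>" "modes_within K S" "1 \<le> K"
  shows "\<exists>l. lyap_exp S \<tau> = ereal l \<and> - K \<le> l"
proof -
  have "lyap_exp S \<tau> \<le> ereal (K + ln K / \<tau>)"
  proof (rule lyap_exp_le[OF assms(1) growth_bounded_letters[OF assms(2,3,1)]])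
    fix z \<sigma> assume z: "z \<in> S" "0 \<le> (\<sigma>::real)"
    then have "norm (drift z \<sigma>) \<le> exp (K * \<sigma>)"
      using assms(2) by (intro norm_drift_le) (auto simp: modes_within_def)
    also have "\<dots> \<le> exp ((K + ln K / \<tau>) * \<sigma> + 0)"
      using assms z(2) by (simp add: distrib_right)
    finally show "norm (drift z \<sigma>) \<le> exp ((K + ln K / \<tau>) * \<sigma> + 0)" .
  qed
  with lyap_exp_ge[OF assms(1,2)] show ?thesis
    by (cases "lyap_exp S \<tau>") auto
qed

lemma growth_of_lyap_exp_less:
  assumes \<tau>: "0 < \<tau>" and S: "modes_within K S" and K: "1 \<le> K" and less: "lyap_exp S \<tau> < ereal \<omega>"
  shows "\<exists>C. \<forall>w\<in>lists (letters S \<tau>). \<forall>z\<in>S. \<forall>\<sigma>\<ge>0.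
    norm (drift z \<sigma> * wprod w) \<le> exp (\<omega> * (dur w + \<sigma>) + C)"
proof -
  let ?sup = "\<lambda>t. SUP Z\<in>dwell_signals S \<tau>. elog (op_norm (flow_matrix Z t))"
  obtain T0 where T0: "\<And>t. T0 \<le> t \<Longrightarrow> ereal (1 / t) * ?sup t < ereal \<omega>"
    using Limsup_lessD[OF less[unfolded lyap_exp_def]] by (auto simp: eventually_at_top_linorder)
  define T where "T = max T0 1"
  define B where "B = K + ln K / \<tau>"
  have B: "0 \<le> B" using K \<tau> by (simp add: B_def)
  show ?thesis
  proof (intro exI[of _ "B * T + \<bar>\<omega>\<bar> * T"] ballI allI impI)
    fix w z \<sigma> assume wz: "w \<in> lists (letters S \<tau>)" "z \<in> S" "(0::real) \<le> \<sigma>"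
    define t where "t = dur w + \<sigma>"
    have t: "0 \<le> t" using dur_nonneg[OF wz(1) letters_nonneg[OF \<tau>]] wz(3) by (simp add: t_def)
    have T: "1 \<le> T" by (simp add: T_def)
    show "norm (drift z \<sigma> * wprod w) \<le> exp (\<omega> * (dur w + \<sigma>) + (B * T + \<bar>\<omega>\<bar> * T))"
    proof (cases "T \<le> t")
      case True
      obtain Z where Z: "Z \<in> dwell_signals S \<tau>" "endo_of (flow_matrix Z t) = drift z \<sigma> * wprod w"
        unfolding t_def by (rule word_flow_matrix[OF wz(1,2) \<tau> wz(3)])
      have t0: "0 < t" using True T by simp
      have "?sup t = ereal t * (ereal (1 / t) * ?sup t)"
        using t0 by (simp flip: mult.assoc)
      also have "\<dots> \<le> ereal t * ereal \<omega>"
        using T0[of t] True t0 by (intro ereal_mult_left_mono) (auto simp: T_def)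
      finally have "elog (op_norm (flow_matrix Z t)) \<le> ereal (t * \<omega>)"
        using SUP_upper[OF Z(1), of "\<lambda>Z. elog (op_norm (flow_matrix Z t))"] by simp
      then have "norm (drift z \<sigma> * wprod w) \<le> exp (t * \<omega>)"
        unfolding Z(2)[symmetric] by (subst (asm) elog_le_iff) (auto simp flip: norm_endo_of)
      also have "\<dots> \<le> exp (\<omega> * (dur w + \<sigma>) + (B * T + \<bar>\<omega>\<bar> * T))"
        using B T by (simp add: t_def mult.commute)
      finally show ?thesis .
    next
      case False
      have z: "norm (drift z \<sigma>) \<le> exp (B * \<sigma>)"
      proof -
        have "norm (drift z \<sigma>) \<le> exp (K * \<sigma>)"
          using S wz(2,3) by (intro norm_drift_le) (auto simp: modes_within_def)
        also have "\<dots> \<le> exp (B * \<sigma>)"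
          using wz(3) K \<tau> by (simp add: B_def distrib_right)
        finally show ?thesis .
      qed
      have "norm (drift z \<sigma> * wprod w) \<le> norm (drift z \<sigma>) * norm (wprod w)"
        by (rule norm_mult_ineq)
      also have "\<dots> \<le> exp (B * \<sigma>) * exp (B * dur w + 0)"
        using growth_boundedD[OF growth_bounded_letters[OF S K \<tau>] wz(1)] z
        by (intro mult_mono) (auto simp: B_def)
      also have "\<dots> = exp (B * t)"
        by (simp add: t_def algebra_simps flip: exp_add)
      also have "\<dots> \<le> exp (\<omega> * t + (B * T + \<bar>\<omega>\<bar> * T))"
      proof -
        have "B * t \<le> B * T" using False B by (intro mult_left_mono) auto
        moreover have "- \<omega> * t \<le> \<bar>\<omega>\<bar> * t" using t by (intro mult_right_mono) auto
        moreover have "\<bar>\<omega>\<bar> * t \<le> \<bar>\<omega>\<bar> * T" using False by (intro mult_left_mono) auto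
        ultimately have "B * t \<le> \<omega> * t + (B * T + \<bar>\<omega>\<bar> * T)" by linarith
        then show ?thesis by simp
      qed
      finally show ?thesis by (simp add: t_def)
    qed
  qed
qed

section \<open>Uniform growth estimates on bounded families\<close>

text \<open>Words over this alphabet sample the flow of the constant signal \<open>z\<close> at multiples of \<open>\<tau>\<close>. This brings a
  single long phase under the estimates for words.\<close>

abbreviation solo :: "('n::finite) mode \<Rightarrow> real \<Rightarrow> (real^'n) timed set" where
  "solo z \<tau> \<equiv> {(\<tau>, drift z \<tau>)}"

lemma wprod_solo: "w \<in> lists (solo z \<tau>) \<Longrightarrow> wprod w = drift z (dur w)"
  by (induction rule: lists.induct) (auto simp: drift_add)

lemma solo_power:
  "\<exists>w\<in>lists (solo z \<tau>). dur w = real n * \<tau>"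
proof (induction n)
  case (Suc n)
  then obtain w where "w \<in> lists (solo z \<tau>)" "dur w = real n * \<tau>" by blast
  then show ?case by (intro bexI[of _ "(\<tau>, drift z \<tau>) # w"]) (auto simp: algebra_simps)
qed (rule bexI[of _ "[]"], auto)

lemma norm_drift_le_of_solo:
  assumes \<tau>: "0 < \<tau>" and solo: "growth_bounded (solo z \<tau>) \<omega> c"
    and K: "norm (endo_of (fst z)) \<le> K" "- K \<le> \<omega>" and \<sigma>: "0 \<le> \<sigma>"
  shows "norm (drift z \<sigma>) \<le> exp (\<omega> * \<sigma> + (c + 2 * K * \<tau>))"
proof -
  define n where "n = nat \<lfloor>\<sigma> / \<tau>\<rfloor>"
  define r where "r = \<sigma> - real n * \<tau>"
  have n: "real n \<le> \<sigma> / \<tau>" "\<sigma> / \<tau> < real n + 1"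
    using \<tau> \<sigma> by (auto simp: n_def)
  then have r: "0 \<le> r" "r \<le> \<tau>"
    using \<tau> by (auto simp: r_def field_simps)
  have K0: "0 \<le> K" using K(1) norm_ge_zero order_trans by blast
  obtain w where w: "w \<in> lists (solo z \<tau>)" "dur w = real n * \<tau>"
    using solo_power by blast
  have "norm (drift z \<sigma>) = norm (drift z r * wprod w)"
    by (simp add: wprod_solo[OF w(1)] w(2) r_def flip: drift_add)
  also have "\<dots> \<le> exp (K * r) * exp (\<omega> * dur w + c)"
    using norm_drift_le[OF K(1) r(1)] growth_boundedD[OF solo w(1)]
    by (intro order_trans[OF norm_mult_ineq] mult_mono) auto
  also have "\<dots> = exp (K * r + (\<omega> * (\<sigma> - r) + c))"
    by (simp add: exp_add w(2) r_def)
  also have "\<dots> \<le> exp (\<omega> * \<sigma> + (c + 2 * K * \<tau>))"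
  proof -
    have "- \<omega> * r \<le> K * r" using K(2) r by (intro mult_right_mono) auto
    moreover have "K * r \<le> K * \<tau>" using K0 r by (intro mult_left_mono) auto
    ultimately have "K * r + (\<omega> * (\<sigma> - r) + c) \<le> \<omega> * \<sigma> + (c + 2 * K * \<tau>)"
      by (simp add: algebra_simps)
    then show ?thesis by simp
  qed
  finally show ?thesis .
qed

text \<open>The estimate on letters in \<open>growth_bounded_uniform\<close> asks for the rate \<open>\<omega>\<close> also on arbitrarily
  long phases. These follow constant signals, whose exponent is at most that of the whole system;
  so the constant signals are treated first, and their bound supplies the letters of the system.\<close>

theorem uniform_growth:
  assumes K: "1 \<le> K" and \<tau>: "0 < \<tau>" and \<epsilon>: "0 < \<epsilon>"
  shows "\<exists>c\<ge>0. \<forall>(S :: ('n::finite) mode set) \<omega>. modes_within K S \<longrightarrow> lyap_exp S \<tau> < ereal \<omega> \<longrightarrow>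
    growth_bounded (letters S \<tau>) (\<omega> + \<epsilon>) c \<and> (\<forall>z\<in>S. growth_bounded (solo z \<tau>) (\<omega> + \<epsilon>) c)"
proof -
  have K\<tau>: "0 \<le> 2 * K * \<tau>" and \<epsilon>2: "0 < \<epsilon> / 2" using K \<tau> \<epsilon> by simp_all
  \<comment> \<open>A single flow grows at most at rate \<open>K\<close> and \<open>\<omega>\<close> exceeds \<open>- K\<close>, so \<open>2 * K\<close> bounds the initial gap.\<close>
  obtain c1 where c1: "growth_bounded P (\<omega> + \<epsilon> / 2) c1"
    if "\<forall>p\<in>P. 0 \<le> fst p \<and> norm (snd p) \<le> exp (\<omega> * fst p + 2 * K * \<tau>)"
      "growth_bounded P \<beta> 0" "growth_bounded P \<omega> C" "\<beta> - \<omega> \<le> 2 * K"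
    for P :: "(real^'n) timed set" and \<beta> \<omega> C
    using growth_bounded_uniform[OF \<epsilon>2 K\<tau>, of "2 * K", where 'a = "real^'n"] by blast
  define b where "b = max 0 (c1 + 2 * K * \<tau> + ln K)"
  have b: "0 \<le> b" by (simp add: b_def)
  obtain c2 where c2: "growth_bounded P (\<omega> + \<epsilon> / 2) c2"
    if "\<forall>p\<in>P. 0 \<le> fst p \<and> norm (snd p) \<le> exp (\<omega> * fst p + b)"
      "growth_bounded P \<beta> 0" "growth_bounded P \<omega> C" "\<beta> - \<omega> \<le> 2 * K + ln K / \<tau>"
    for P :: "(real^'n) timed set" and \<beta> \<omega> C
    using growth_bounded_uniform[OF \<epsilon>2 b, of "2 * K + ln K / \<tau>", where 'a = "real^'n"] by blast
  show ?thesis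
  proof (intro exI[of _ "max 0 (max c1 c2)"] conjI allI impI)
    fix S :: "'n mode set" and \<omega> assume S: "modes_within K S" and less: "lyap_exp S \<tau> < ereal \<omega>"
    obtain C where C: "\<And>w z \<sigma>. w \<in> lists (letters S \<tau>) \<Longrightarrow> z \<in> S \<Longrightarrow> 0 \<le> \<sigma> \<Longrightarrow>
        norm (drift z \<sigma> * wprod w) \<le> exp (\<omega> * (dur w + \<sigma>) + C)"
      using growth_of_lyap_exp_less[OF \<tau> S K less] by blast
    have "ereal (- K) < ereal \<omega>"
      using lyap_exp_ge[OF \<tau> S] less by (rule le_less_trans)
    then have \<omega>: "- K < \<omega>" by simp
    have Kz: "norm (endo_of (fst z)) \<le> K" "norm (endo_of (snd z)) \<le> K" if "z \<in> S" for z
      using S that by (auto simp: modes_within_def)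
    have solo: "growth_bounded (solo z \<tau>) (\<omega> + \<epsilon> / 2) c1" if z: "z \<in> S" for z
    proof (rule c1)
      have "norm (drift z \<tau>) \<le> exp (K * \<tau>)"
        using Kz[OF z] \<tau> by (intro norm_drift_le) auto
      also have "K * \<tau> \<le> (\<omega> + 2 * K) * \<tau>"
        using \<omega> \<tau> by (intro mult_right_mono) auto
      finally show "\<forall>p\<in>solo z \<tau>. 0 \<le> fst p \<and> norm (snd p) \<le> exp (\<omega> * fst p + 2 * K * \<tau>)"
        using \<tau> by (simp add: distrib_right)
      show "growth_bounded (solo z \<tau>) K 0"
        using norm_drift_le[OF Kz(1)[OF z], of \<tau>] \<tau> by (intro growth_bounded_submultiplicative) auto
      show "growth_bounded (solo z \<tau>) \<omega> C"
        unfolding growth_bounded_def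
      proof
        fix w assume w: "w \<in> lists (solo z \<tau>)"
        have "0 \<le> dur w" using dur_nonneg[OF w] \<tau> by auto
        with C[of "[]" z "dur w"] z show "norm (wprod w) \<le> exp (\<omega> * dur w + C)"
          by (simp add: wprod_solo[OF w])
      qed
    qed (use \<omega> in auto)
    have letters: "growth_bounded (letters S \<tau>) (\<omega> + \<epsilon> / 2 + \<epsilon> / 2) c2"
    proof (rule c2)
      show "\<forall>p\<in>letters S \<tau>. 0 \<le> fst p \<and> norm (snd p) \<le> exp ((\<omega> + \<epsilon> / 2) * fst p + b)"
      proof (intro ballI conjI)
        fix p assume p: "p \<in> letters S \<tau>"
        then show "0 \<le> fst p" by (rule letters_nonneg[OF \<tau>])
        from p obtain z s where zs: "p = letter z s" "z \<in> S" "\<tau> \<le> s" by (auto simp: letters_def)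
        have "norm (snd p) \<le> norm (endo_of (snd z)) * norm (drift z s)"
          by (simp add: zs letter_def norm_mult_ineq)
        also have "\<dots> \<le> exp (ln K) * exp ((\<omega> + \<epsilon> / 2) * s + (c1 + 2 * K * \<tau>))"
          using zs K \<omega> \<epsilon> \<tau> Kz[OF zs(2)]
          by (intro mult_mono norm_drift_le_of_solo[OF \<tau> solo]) auto
        also have "\<dots> \<le> exp ((\<omega> + \<epsilon> / 2) * fst p + b)"
          unfolding exp_add[symmetric] by (simp add: zs letter_def b_def)
        finally show "norm (snd p) \<le> exp ((\<omega> + \<epsilon> / 2) * fst p + b)" .
      qed
      show "growth_bounded (letters S \<tau>) (K + ln K / \<tau>) 0"
        by (rule growth_bounded_letters[OF S K \<tau>])
      obtain z where z: "z \<in> S" using S by (auto simp: modes_within_def)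
      have "growth_bounded (letters S \<tau>) \<omega> C"
        unfolding growth_bounded_def using C[OF _ z, of _ 0] by simp
      then show "growth_bounded (letters S \<tau>) (\<omega> + \<epsilon> / 2) C"
        by (rule growth_bounded_mono) (use \<epsilon> letters_nonneg[OF \<tau>] in auto)
    qed (use \<omega> \<epsilon> in auto)
    show "growth_bounded (letters S \<tau>) (\<omega> + \<epsilon>) (max 0 (max c1 c2))"
      by (rule growth_bounded_mono[OF letters]) (use letters_nonneg[OF \<tau>] in auto)
    show "\<forall>z\<in>S. growth_bounded (solo z \<tau>) (\<omega> + \<epsilon>) (max 0 (max c1 c2))"
      using \<tau> \<epsilon> by (auto intro!: growth_bounded_mono[OF solo])
  qed simp
qed

section \<open>Perturbation of the set of modes\<close>

text \<open>Room for the perturbation in \<open>growth_bounded_perturb\<close>: on durations between \<open>\<tau>\<close> and \<open>L\<close>, raising the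
  rate by \<open>\<eta>\<close> leaves a gap that is bounded below in terms of \<open>K\<close>, \<open>L\<close>, \<open>\<eta>\<close> and \<open>\<tau>\<close>.\<close>

lemma exp_rate_gap:
  fixes \<omega> \<eta> :: real
  assumes "- K \<le> \<omega>" "0 \<le> \<eta>" "0 \<le> \<tau>" "\<tau> \<le> s" "s \<le> L" "0 \<le> K"
  shows "exp (\<omega> * s) + exp (- K * L) * (\<eta> * \<tau>) \<le> exp ((\<omega> + \<eta>) * s)"
proof -
  have "exp (- K * L) * (\<eta> * \<tau>) \<le> exp (\<omega> * s) * (\<eta> * s)"
  proof (intro mult_mono)
    have "- K * L \<le> - K * s" using assms by (simp add: mult_left_mono)
    also have "\<dots> \<le> \<omega> * s" using assms by (intro mult_right_mono) auto
    finally show "exp (- K * L) \<le> exp (\<omega> * s)" by simp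
  qed (use assms in \<open>auto intro: mult_left_mono\<close>)
  also have "\<dots> \<le> exp (\<omega> * s) * (exp (\<eta> * s) - 1)"
  proof (rule mult_left_mono)
    show "\<eta> * s \<le> exp (\<eta> * s) - 1"
      using exp_ge_add_one_self[of "\<eta> * s"] by linarith
  qed simp
  finally show ?thesis by (simp add: distrib_right exp_add algebra_simps)
qed

lemma letter_close:
  assumes "0 \<le> K" "0 \<le> L" "0 < \<kappa>"
  shows "\<exists>\<delta>>0. \<forall>(z :: ('n::finite) mode) z' s. modes_within K {z, z'} \<longrightarrow> dist z z' < \<delta> \<longrightarrow>
    0 \<le> s \<longrightarrow> s \<le> L \<longrightarrow>
    norm (drift z' s - drift z s) \<le> \<kappa> \<and> norm (snd (letter z' s) - snd (letter z s)) \<le> \<kappa>"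
proof -
  obtain C where C: "0 < C" "\<And>M :: real^'n^'n. norm (endo_of M) \<le> norm M * C"
    using bounded_linear.pos_bounded[OF bounded_linear_endo_of] by blast
  define M where "M = exp (K * L) * L * C + exp (K * L) * C + K * (exp (K * L) * L * C)"
  have M: "0 < M" using assms C(1) by (simp add: M_def add_nonneg_pos add_pos_nonneg)
  have main: "norm (drift z' s - drift z s) \<le> \<kappa> \<and> norm (snd (letter z' s) - snd (letter z s)) \<le> \<kappa>"
    if z: "modes_within K {z, z'}" and d: "dist z z' < \<kappa> / M" and s: "0 \<le> s" "s \<le> L"
    for z z' :: "'n mode" and s
  proof -
    let ?d = "dist z z'"
    have K: "norm (endo_of (fst z)) \<le> K" "norm (endo_of (snd z)) \<le> K"
      "norm (endo_of (fst z')) \<le> K" "norm (endo_of (snd z')) \<le> K"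
      using z by (auto simp: modes_within_def)
    have diff: "endo_of A - endo_of B = endo_of (A - B)" for A B :: "real^'n^'n"
      by (simp add: bounded_linear_endo_of bounded_linear.linear linear_diff)
    have f: "norm (endo_of (fst z') - endo_of (fst z)) \<le> ?d * C"
      unfolding diff using C(2)[of "fst z' - fst z"] dist_fst_le[of z' z] C(1)
      by (metis (no_types, opaque_lifting) dist_commute dist_norm mult_right_mono less_imp_le order_trans)
    have g: "norm (endo_of (snd z') - endo_of (snd z)) \<le> ?d * C"
      unfolding diff using C(2)[of "snd z' - snd z"] dist_snd_le[of z' z] C(1)
      by (metis (no_types, opaque_lifting) dist_commute dist_norm mult_right_mono less_imp_le order_trans)
    have sK: "norm (s *\<^sub>R endo_of (fst y)) \<le> K * L" if "norm (endo_of (fst y)) \<le> K" for y :: "'n mode"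
      using that s assms by (simp add: mult.commute[of K]) (intro mult_mono, auto)
    have "norm (drift z' s - drift z s) \<le> exp (K * L) * norm (s *\<^sub>R endo_of (fst z') - s *\<^sub>R endo_of (fst z))"
      unfolding drift_def by (intro norm_exp_diff_le sK K)
    also have "\<dots> = exp (K * L) * (s * norm (endo_of (fst z') - endo_of (fst z)))"
      using s by (simp flip: scaleR_diff_right)
    also have "\<dots> \<le> exp (K * L) * (L * (?d * C))"
      using f s assms by (intro mult_left_mono mult_mono) auto
    finally have 1: "norm (drift z' s - drift z s) \<le> exp (K * L) * L * C * ?d"
      by (simp add: mult_ac)
    have Md: "M * ?d \<le> \<kappa>"
      using d M by (simp add: field_simps)
    have nn: "0 \<le> exp (K * L) * L * C * ?d" "0 \<le> exp (K * L) * C * ?d" "0 \<le> K * (exp (K * L) * L * C * ?d)"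
      using assms C(1) by auto
    have "snd (letter z' s) - snd (letter z s) =
        (endo_of (snd z') - endo_of (snd z)) * drift z' s + endo_of (snd z) * (drift z' s - drift z s)"
      by (simp add: letter_def algebra_simps)
    then have "norm (snd (letter z' s) - snd (letter z s)) \<le>
        norm (endo_of (snd z') - endo_of (snd z)) * norm (drift z' s) + norm (endo_of (snd z)) * norm (drift z' s - drift z s)"
      by (metis (no_types, lifting) norm_mult_ineq norm_triangle_mono)
    also have "\<dots> \<le> ?d * C * exp (K * L) + K * (exp (K * L) * L * C * ?d)"
    proof (intro add_mono mult_mono g K 1)
      have "norm (drift z' s) \<le> exp (K * s)" using K s by (intro norm_drift_le)
      also have "\<dots> \<le> exp (K * L)" using s assms by (simp add: mult_left_mono)
      finally show "norm (drift z' s) \<le> exp (K * L)" .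
    qed (use assms C(1) in auto)
    finally have 2: "norm (snd (letter z' s) - snd (letter z s)) \<le> exp (K * L) * C * ?d + K * (exp (K * L) * L * C * ?d)"
      by (simp add: mult_ac)
    have "M * ?d = exp (K * L) * L * C * ?d + exp (K * L) * C * ?d + K * (exp (K * L) * L * C * ?d)"
      by (simp add: M_def algebra_simps)
    with 1 2 Md nn show ?thesis by linarith
  qed
  show ?thesis
    by (rule exI[of _ "\<kappa> / M"]) (use main M assms(3) in auto)
qed

text \<open>\<open>\<delta>\<close> is uniform over all sets of modes bounded by \<open>K\<close>. This yields both semicontinuities at once, since
  the roles of \<open>S\<close> and \<open>S'\<close> can be exchanged.\<close>

theorem lyap_exp_perturb:
  assumes K: "1 \<le> K" and \<tau>: "0 < \<tau>" and \<epsilon>: "0 < \<epsilon>"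
  shows "\<exists>\<delta>>0. \<forall>(S :: ('n::finite) mode set) S'. modes_within K S \<longrightarrow> modes_within K S' \<longrightarrow>
    (\<forall>z'\<in>S'. \<exists>z\<in>S. dist z z' < \<delta>) \<longrightarrow> lyap_exp S' \<tau> \<le> lyap_exp S \<tau> + ereal \<epsilon>"
proof -
  \<comment> \<open>Four losses of \<open>\<eta>\<close>: the strict inequality for the rate in \<open>uniform_growth\<close>, its \<open>\<epsilon>\<close>, the perturbation
    of the constant signals, and the absorption of the constants on long phases.\<close>
  define \<eta> where "\<eta> = \<epsilon> / 4"
  have \<eta>: "0 < \<eta>" using \<epsilon> by (simp add: \<eta>_def)
  obtain c where c0: "0 \<le> c" and c: "\<And>(S :: 'n mode set) \<omega>. modes_within K S \<Longrightarrow> lyap_exp S \<tau> < ereal \<omega> \<Longrightarrow>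
    growth_bounded (letters S \<tau>) (\<omega> + \<eta>) c \<and> (\<forall>z\<in>S. growth_bounded (solo z \<tau>) (\<omega> + \<eta>) c)"
    using uniform_growth[OF K \<tau> \<eta>, where 'n = 'n] by blast
  \<comment> \<open>Phases longer than \<open>L\<close> are handled through the constant signals alone; at duration \<open>L\<close> a gain \<open>\<eta>\<close>
    in the rate outweighs all constants, including the bound \<open>K\<close> of the jump.\<close>
  define L where "L = max \<tau> ((2 * c + 2 * K * \<tau> + ln K) / \<eta>)"
  define \<kappa> where "\<kappa> = exp (- c) * (exp (- K * L) * (\<eta> * \<tau>))"
  have L: "\<tau> \<le> L" "0 \<le> L" using \<tau> by (auto simp: L_def)
  have \<kappa>: "0 < \<kappa>" using \<eta> \<tau> by (simp add: \<kappa>_def)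
  have K0: "0 \<le> K" using K by simp
  obtain \<delta> where \<delta>: "0 < \<delta>" and close: "\<And>(z :: 'n mode) z' s. modes_within K {z, z'} \<Longrightarrow> dist z z' < \<delta> \<Longrightarrow>
    0 \<le> s \<Longrightarrow> s \<le> L \<Longrightarrow>
    norm (drift z' s - drift z s) \<le> \<kappa> \<and> norm (snd (letter z' s) - snd (letter z s)) \<le> \<kappa>"
    using letter_close[OF K0 L(2) \<kappa>, where 'n = 'n] by blast
  show ?thesis
  proof (intro exI[of _ \<delta>] conjI allI impI \<delta>)
    fix S S' :: "'n mode set"
    assume S: "modes_within K S" and S': "modes_within K S'" and near: "\<forall>z'\<in>S'. \<exists>z\<in>S. dist z z' < \<delta>"
    obtain l where l: "lyap_exp S \<tau> = ereal l" "- K \<le> l"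
      using lyap_exp_finite[OF \<tau> S K] by blast
    have less: "lyap_exp S \<tau> < ereal (l + \<eta>)" using l \<eta> by simp
    note gS = c[OF S less]
    have kap: "exp (\<omega> * s) + exp c * x \<le> exp ((\<omega> + \<eta>) * s)"
      if "- K \<le> \<omega>" "\<tau> \<le> s" "s \<le> L" "x \<le> \<kappa>" for \<omega> s x
    proof -
      have "exp c * x \<le> exp c * \<kappa>" using that(4) by simp
      also have "\<dots> = exp (- K * L) * (\<eta> * \<tau>)"
        by (simp add: \<kappa>_def exp_minus)
      finally show ?thesis
        using exp_rate_gap[of K \<omega> \<eta> \<tau> s L] that \<eta> \<tau> K0 by simp
    qed
    have pair: "modes_within K {z, z'}" if "z \<in> S" "z' \<in> S'" for z z'
      using S S' that by (auto simp: modes_within_def)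
    have K': "norm (endo_of (fst z)) \<le> K" "norm (endo_of (snd z)) \<le> K" if "z \<in> S'" for z
      using S' that by (auto simp: modes_within_def)
    have drift': "norm (drift z' \<sigma>) \<le> exp ((l + 3 * \<eta>) * \<sigma> + (c + 2 * K * \<tau>))"
      if z': "z' \<in> S'" and \<sigma>: "0 \<le> \<sigma>" for z' \<sigma>
    proof (rule norm_drift_le_of_solo[OF \<tau> _ K'(1)[OF z'] _ \<sigma>])
      obtain z where z: "z \<in> S" "dist z z' < \<delta>" using near z' by blast
      show "growth_bounded (solo z' \<tau>) (l + 3 * \<eta>) c"
      proof (rule growth_bounded_perturb)
        show "growth_bounded (solo z \<tau>) (l + \<eta> + \<eta>) c" using gS z(1) by blast
        fix s A' assume "(s, A') \<in> solo z' \<tau>"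
        then have A': "s = \<tau>" "A' = drift z' \<tau>" by auto
        have "exp ((l + \<eta> + \<eta>) * \<tau>) + exp c * norm (drift z' \<tau> - drift z \<tau>) \<le> exp ((l + \<eta> + \<eta> + \<eta>) * \<tau>)"
          using close[OF pair[OF z(1) z'] z(2), of \<tau>] \<tau> L l(2) \<eta> by (intro kap) auto
        then show "norm A' \<le> exp ((l + 3 * \<eta>) * s - c) \<or>
          (\<exists>A. (s, A) \<in> solo z \<tau> \<and> exp ((l + \<eta> + \<eta>) * s) + exp c * norm (A' - A) \<le> exp ((l + 3 * \<eta>) * s))"
          unfolding A' by (intro disjI2 exI[of _ "drift z \<tau>"]) (simp add: algebra_simps)
      qed
    qed (use l(2) \<eta> in auto)
    have "growth_bounded (letters S' \<tau>) (l + 4 * \<eta>) c"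
    proof (rule growth_bounded_perturb)
      show "growth_bounded (letters S \<tau>) (l + \<eta> + \<eta>) c" using gS by blast
      fix s A' assume "(s, A') \<in> letters S' \<tau>"
      then obtain z' where z': "z' \<in> S'" "\<tau> \<le> s" "A' = snd (letter z' s)"
        unfolding letters_def by (auto simp: letter_def)
      show "norm A' \<le> exp ((l + 4 * \<eta>) * s - c) \<or>
          (\<exists>A. (s, A) \<in> letters S \<tau> \<and> exp ((l + \<eta> + \<eta>) * s) + exp c * norm (A' - A) \<le> exp ((l + 4 * \<eta>) * s))"
      proof (cases "s \<le> L")
        case True
        obtain z where z: "z \<in> S" "dist z z' < \<delta>" using near z'(1) by blast
        have "exp ((l + \<eta> + \<eta>) * s) + exp c * norm (A' - snd (letter z s)) \<le> exp ((l + \<eta> + \<eta> + \<eta>) * s)"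
          unfolding z'(3)
          using close[OF pair[OF z(1) z'(1)] z(2), of s] z'(2) True \<tau> l(2) \<eta> by (intro kap) auto
        also have "\<dots> \<le> exp ((l + 4 * \<eta>) * s)"
          using \<eta> z'(2) \<tau> by (simp add: mult_right_mono)
        finally have "exp ((l + \<eta> + \<eta>) * s) + exp c * norm (A' - snd (letter z s)) \<le> exp ((l + 4 * \<eta>) * s)" .
        moreover have "(s, snd (letter z s)) \<in> letters S \<tau>"
        proof -
          have "(s, snd (letter z s)) = letter z s" by (simp add: letter_def)
          then show ?thesis using z(1) z'(2) unfolding letters_def by blast
        qed
        ultimately show ?thesis by blast
      next
        case False
        have "(2 * c + 2 * K * \<tau> + ln K) / \<eta> \<le> s" using False by (simp add: L_def)
        then have s: "2 * c + 2 * K * \<tau> + ln K \<le> \<eta> * s" using \<eta> by (simp add: field_simps)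
        have "norm A' \<le> norm (endo_of (snd z')) * norm (drift z' s)"
          by (simp add: z'(3) letter_def norm_mult_ineq)
        also have "\<dots> \<le> exp (ln K) * exp ((l + 3 * \<eta>) * s + (c + 2 * K * \<tau>))"
          using K K'[OF z'(1)] z' \<tau> by (intro mult_mono drift') auto
        also have "\<dots> \<le> exp ((l + 4 * \<eta>) * s - c)"
          unfolding exp_add[symmetric] using s by (simp add: algebra_simps)
        finally show ?thesis by blast
      qed
    qed
    then have "lyap_exp S' \<tau> \<le> ereal (l + 4 * \<eta>)"
    proof (rule lyap_exp_le[OF \<tau>])
      fix z \<sigma> assume z: "z \<in> S'" "0 \<le> (\<sigma>::real)"
      have "norm (drift z \<sigma>) \<le> exp ((l + 3 * \<eta>) * \<sigma> + (c + 2 * K * \<tau>))"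
        by (rule drift'[OF z])
      also have "\<dots> \<le> exp ((l + 4 * \<eta>) * \<sigma> + (c + 2 * K * \<tau>))"
        using z(2) \<eta> by (simp add: mult_right_mono)
      finally show "norm (drift z \<sigma>) \<le> exp ((l + 4 * \<eta>) * \<sigma> + (c + 2 * K * \<tau>))" .
    qed
    then show "lyap_exp S' \<tau> \<le> lyap_exp S \<tau> + ereal \<epsilon>"
      by (simp add: l(1) \<eta>_def)
  qed
qed

section \<open>Hausdorff neighbourhoods\<close>

lemma hausdorff_dist_lessD:
  fixes X Y :: "'a::metric_space set"
  assumes X: "X \<in> bounded_sets" and Y: "Y \<in> bounded_sets" and less: "hausdorff_dist X Y < r"
  shows "x \<in> X \<Longrightarrow> \<exists>y\<in>Y. dist x y < r" "y \<in> Y \<Longrightarrow> \<exists>x\<in>X. dist x y < r"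
proof -
  have "bounded (X \<union> Y)" and ne: "X \<noteq> {}" "Y \<noteq> {}"
    using X Y by (auto simp: bounded_sets_def)
  then obtain D where D: "\<And>x y. x \<in> X \<Longrightarrow> y \<in> Y \<Longrightarrow> dist x y \<le> D"
    using bounded_two_points[of "X \<union> Y"] by blast
  have bb: "bdd_below ((\<lambda>y. dist x y) ` A)" "bdd_below ((\<lambda>x. dist x y) ` A)" for x y :: 'a and A
    by (auto intro: bdd_belowI[of _ 0])
  obtain x0 y0 where 0: "x0 \<in> X" "y0 \<in> Y" using ne by blast
  show "\<exists>y\<in>Y. dist x y < r" if x: "x \<in> X" for x
  proof -
    have "bdd_above ((\<lambda>x. INF y\<in>Y. dist x y) ` X)"
      by (rule bdd_aboveI2[of _ _ D]) (use 0 D in \<open>auto intro: cINF_lower2[OF bb(1)]\<close>)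
    from cSUP_upper[OF x this] less have "(INF y\<in>Y. dist x y) < r"
      by (simp add: hausdorff_dist_def)
    then show ?thesis
      using cINF_less_iff[OF ne(2) bb(1)] by blast
  qed
  show "\<exists>x\<in>X. dist x y < r" if y: "y \<in> Y" for y
  proof -
    have "bdd_above ((\<lambda>y. INF x\<in>X. dist x y) ` Y)"
      by (rule bdd_aboveI2[of _ _ D]) (use 0 D in \<open>auto intro: cINF_lower2[OF bb(2)]\<close>)
    from cSUP_upper[OF y this] less have "(INF x\<in>X. dist x y) < r"
      by (simp add: hausdorff_dist_def)
    then show ?thesis
      using cINF_less_iff[OF ne(1) bb(2)] by blast
  qed
qed

lemma hausdorff_dist_self:
  fixes X :: "'a::metric_space set"
  assumes "X \<noteq> {}"
  shows "hausdorff_dist X X = 0"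
proof -
  have 1: "(INF y\<in>X. dist x y) = 0" if "x \<in> X" for x
  proof (rule antisym)
    show "(INF y\<in>X. dist x y) \<le> 0"
      using cINF_lower[of "dist x" X x] that by (auto intro: bdd_belowI[of _ 0])
    show "0 \<le> (INF y\<in>X. dist x y)"
      by (rule cINF_greatest) (use that in auto)
  qed
  then have 2: "(INF y\<in>X. dist y x) = 0" if "x \<in> X" for x
    using that by (simp add: dist_commute[of _ x])
  from 1 2 assms show ?thesis
    by (simp add: hausdorff_dist_def)
qed

lemma openin_hausdorff_ball:
  assumes "X \<in> bounded_sets" "0 < r"
  shows "openin hausdorff_topology {Y \<in> bounded_sets. hausdorff_dist X Y < r}"
  unfolding hausdorff_topology_def using assms by (intro topology_generated_by_Basis) blast

text \<open>One bound \<open>K\<close> serves a whole Hausdorff neighbourhood of \<open>S\<close>, as \<open>lyap_exp_perturb\<close> requires.\<close>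

lemma modes_within_of_bounded:
  fixes S :: "('n::finite) mode set"
  assumes "S \<in> bounded_sets"
  shows "\<exists>K\<ge>1. modes_within K S \<and>
    (\<forall>S'\<in>bounded_sets. (\<forall>z'\<in>S'. \<exists>z\<in>S. dist z z' < 1) \<longrightarrow> modes_within K S')"
proof -
  obtain C where C: "0 < C" "\<And>M :: real^'n^'n. norm (endo_of M) \<le> norm M * C"
    using bounded_linear.pos_bounded[OF bounded_linear_endo_of] by blast
  obtain R where R: "\<And>z. z \<in> S \<Longrightarrow> norm z \<le> R"
    using assms by (auto simp: bounded_sets_def bounded_iff)
  define K where "K = max 1 ((R + 1) * C)"
  have K: "norm (endo_of (fst z)) \<le> K \<and> norm (endo_of (snd z)) \<le> K" if "norm z \<le> R + 1" for z :: "'n mode"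
  proof -
    have "norm (fst z) \<le> R + 1" "norm (snd z) \<le> R + 1"
      using that norm_fst_le[of "fst z" "snd z"] norm_snd_le[of "snd z" "fst z"] by auto
    then have "norm (fst z) * C \<le> (R + 1) * C" "norm (snd z) * C \<le> (R + 1) * C"
      using C(1) by (auto intro!: mult_right_mono)
    with C(2)[of "fst z"] C(2)[of "snd z"] show ?thesis
      by (auto simp: K_def)
  qed
  have "norm z' \<le> R + 1" if "z \<in> S" "dist z z' < 1" for z z'
    using norm_triangle_ineq[of z "z' - z"] R[OF that(1)] that(2) by (simp add: dist_norm norm_minus_commute)
  with K have "modes_within K S'" if "S' \<in> bounded_sets" "\<forall>z'\<in>S'. \<exists>z\<in>S. dist z z' < 1" for S'
    using that by (fastforce simp: modes_within_def bounded_sets_def)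
  moreover from this[OF assms] have "modes_within K S"
    by (metis dist_self zero_less_one)
  moreover have "1 \<le> K" by (simp add: K_def)
  ultimately show ?thesis by blast
qed

theorem proposition6:
  fixes \<tau> :: real
  assumes "0 < \<tau>"
  shows "continuous_map hausdorff_topology euclidean
           (\<lambda>S :: ('n::finite) mode set. lyap_exp S \<tau>)"
  unfolding continuous_map_def
proof (intro conjI allI impI)
  fix U :: "ereal set" assume "openin euclidean U"
  then have U: "open U" by simp
  show "openin hausdorff_topology {S \<in> topspace hausdorff_topology. lyap_exp (S :: 'n mode set) \<tau> \<in> U}"
  proof (subst openin_subopen, intro ballI)
    fix S :: "'n mode set" assume "S \<in> {S \<in> topspace hausdorff_topology. lyap_exp S \<tau> \<in> U}"
    then have S: "S \<in> bounded_sets" "lyap_exp S \<tau> \<in> U"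
      by (auto simp: topspace_hausdorff_topology)
    obtain K where K: "1 \<le> K" "modes_within K S"
      "\<And>S'. S' \<in> bounded_sets \<Longrightarrow> \<forall>z'\<in>S'. \<exists>z\<in>S. dist z z' < 1 \<Longrightarrow> modes_within K S'"
      using modes_within_of_bounded[OF S(1)] by blast
    obtain l where l: "lyap_exp S \<tau> = ereal l"
      using lyap_exp_finite[OF assms K(2,1)] by blast
    obtain e where e: "0 < e" "{ereal l - e<..<ereal l + e} \<subseteq> U"
      using ereal_open_cont_interval[OF U S(2)] l by auto
    obtain \<epsilon> where \<epsilon>: "0 < \<epsilon>" "ereal \<epsilon> < e"
      using e(1) ereal_dense2[of 0 e] by auto
    obtain \<delta> where \<delta>: "0 < \<delta>" "\<And>(S :: 'n mode set) S'. modes_within K S \<Longrightarrow> modes_within K S' \<Longrightarrow>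
      \<forall>z'\<in>S'. \<exists>z\<in>S. dist z z' < \<delta> \<Longrightarrow> lyap_exp S' \<tau> \<le> lyap_exp S \<tau> + ereal \<epsilon>"
      using lyap_exp_perturb[OF K(1) assms \<epsilon>(1), where 'n = 'n] by blast
    define r where "r = min \<delta> 1"
    let ?B = "{S' \<in> bounded_sets. hausdorff_dist S S' < r}"
    have "lyap_exp S' \<tau> \<in> U" if "S' \<in> ?B" for S'
    proof -
      have S': "S' \<in> bounded_sets" "hausdorff_dist S S' < r" using that by auto
      note near = hausdorff_dist_lessD[OF S(1) S']
      have K': "modes_within K S'"
        using near(2) by (intro K(3) S') (force simp: r_def)
      obtain l' where l': "lyap_exp S' \<tau> = ereal l'"
        using lyap_exp_finite[OF assms K' K(1)] by blast
      have "lyap_exp S' \<tau> \<le> lyap_exp S \<tau> + ereal \<epsilon>"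
        using near(2) by (intro \<delta>(2) K K') (force simp: r_def)
      moreover have "lyap_exp S \<tau> \<le> lyap_exp S' \<tau> + ereal \<epsilon>"
        using near(1) by (intro \<delta>(2) K K') (force simp: r_def dist_commute)
      ultimately have "\<bar>l' - l\<bar> \<le> \<epsilon>" by (simp add: l l')
      then have "lyap_exp S' \<tau> \<in> {ereal l - e<..<ereal l + e}"
        unfolding l' using \<epsilon> by (cases e) auto
      with e(2) show ?thesis by blast
    qed
    moreover have "S \<in> ?B"
      using S(1) \<delta>(1) hausdorff_dist_self[of S] by (auto simp: bounded_sets_def r_def)
    moreover have "openin hausdorff_topology ?B"
      using S(1) \<delta>(1) by (intro openin_hausdorff_ball) (auto simp: r_def)
    ultimately show "\<exists>T. openin hausdorff_topology T \<and> S \<in> T \<and>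
        T \<subseteq> {S \<in> topspace hausdorff_topology. lyap_exp S \<tau> \<in> U}"
      by (intro exI[of _ ?B]) (auto simp: topspace_hausdorff_topology)
  qed
qed simp

end
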